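(* Let $X$ be a proper, $\delta$-hyperbolic metric space and let $\Gamma < \mathrm{Isom}(X)$ be non-elementary and discrete. Then $$h_\Gamma = \mathrm{PD}(\Lambda_{\mathrm{erg}}(\Gamma)),$$ where $h_\Gamma$ is the critical exponent of $\Gamma$, $\Lambda_{\mathrm{erg}}(\Gamma)\subseteq\partial X$ is the ergodic limit set of $\Gamma$ and $\mathrm{PD}$ is the visual (generalized) packing dimension.
   Context: Hyperbolicity. For a geodesic metric space $X$ and $x,y,z\in X$ put $(y,z)_x=\frac12\big(d(x,y)+d(x,z)-d(y,z)\big)$. A geodesic metric space $X$ is $\delta$-hyperbolic ($\delta\ge 0$) if $(x,z)_w\ge\min\{(x,y)_w,(y,z)_w\}-\delta$ for all $x,y,z,w\in X$. (So $\delta$-hyperbolic spaces are geodesic by convention.) Proper means that closed balls are compact. Boundary. $\partial X$ is the set of sequences $(z_n)$ in $X$ with $\lim_{n,m\to+\infty}(z_n,z_m)_x=+\infty$, modulo the relation $(z_n)\sim(z_n')$ iff $\lim_{n,m\to+\infty}(z_n,z'_m)_x=+\infty$; we say $(z_n)$ converges to its class. This does not depend on $x$. A geodesic ray is an isometric embedding $\xi:[0,+\infty)\to X$; its endpoint is $\xi^+=[(\xi(n))_n]\in\partial X$. A geodesic ray $\xi$ with $\xi(0)=x$ and $\xi^+=z$ is denoted $[x,z]$ (it exists for all $x\in X$, $z\in\partial X$, but need not be unique). The Gromov product on the boundary is $(z,z')_x=\sup\liminf_{n,m\to+\infty}(z_n,z'_m)_x$, the supremum being over all sequences $(z_n)$,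 $(z'_n)$ in $X$ converging to $z$, $z'$ respectively. Groups. $\mathrm{Isom}(X)$ is the isometry group of $X$ with the topology of uniform convergence on compact sets. $\Gamma<\mathrm{Isom}(X)$ is discrete if for every $x\in X$ and $R\ge0$ the set $\{g\in\Gamma: d(x,gx)\le R\}$ is finite. The limit set $\Lambda(\Gamma)$ is the set of accumulation points in $\partial X$ of an orbit $\Gamma x$ (independent of $x$); $\Gamma$ is non-elementary if $\Lambda(\Gamma)$ has more than two points. The critical exponent is $h_\Gamma=\limsup_{T\to+\infty}\frac1T\log\#(\Gamma x\cap B(x,T))\in[0,+\infty]$, where $B(x,T)$ is the open ball; it is independent of $x\in X$. Ergodic limit set. Fix $x\in X$. For $\tau>0$ and an increasing sequence $\Theta=\{\vartheta_i\}_{i\in\mathbb N}$ of real numbers with $\vartheta_i\to+\infty$, let $\Lambda_{\tau,\Theta}(\Gamma)$ be the set of $z\in\partial X$ such that there exists a geodesic ray $[x,z]$ with the property: for every $i\in\mathbb N$ there is a point $y_i\in[x,z]$ with $d(x,y_i)\in[\vartheta_i,\vartheta_{i+1}]$ and $d(y_i,\Gamma x)\le\tau$. Let $\Theta_{\mathrm{erg}}$ be the set of such sequences $\Theta$ for which $\lim_{i\to+\infty}\vartheta_i/i$ exists and belongs to $(0,+\infty)$. The ergodic limit set is $\Lambda_{\mathrm{erg}}(\Gamma)=\bigcup_{\tau>0}\bigcup_{\Theta\in\Theta_{\mathrm{erg}}}\Lambda_{\tau,\Theta}(\Gamma)$; it does not depend on $x$. Visual packing dimension. Fix $x\in X$.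 For $z\in\partial X$ and $\rho>0$ the generalized visual ball is $B(z,\rho)=\{z'\in\partial X:(z,z')_x>\log\frac1\rho\}$. $\partial X$ carries its standard topology, for which these sets form a system of (not necessarily open) neighbourhoods of $z$. For $\alpha\ge0$ and $B\subseteq\partial X$ put $$\mathcal P^\alpha(B)=\lim_{\eta\to0}\sup\Big\{\sum_i\rho_i^\alpha:\ B(z_i,\rho_i)\text{ pairwise disjoint},\ z_i\in B,\ 0<\rho_i\le\eta\Big\}$$ (the supremum over countable, possibly finite, families), and $$\hat{\mathcal P}^\alpha(B)=\inf\Big\{\sum_{k=1}^\infty\mathcal P^\alpha(B_k):\ B\subseteq\bigcup_{k=1}^\infty B_k,\ B_k\subseteq\partial X\text{ Borel}\Big\}.$$ Then $\mathrm{PD}(B)\in[0,+\infty]$ is the critical value of $\alpha$: $\hat{\mathcal P}^{\alpha'}(B)=0$ for $\alpha'>\mathrm{PD}(B)$ and $\hat{\mathcal P}^{\alpha'}(B)=+\infty$ for $0\le\alpha'<\mathrm{PD}(B)$. It is independent of $x$. *)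

theory Defs
  imports "HOL-Analysis.Analysis" "HOL-Algebra.Group"
begin

section \<open>Proper hyperbolic spaces\<close>

definition proper_space :: "'a::metric_space itself \<Rightarrow> bool" where
  "proper_space _ \<longleftrightarrow> (\<forall>(x::'a) r. compact (cball x r))"

definition geodesic_space :: "'a::metric_space itself \<Rightarrow> bool" where
  "geodesic_space _ \<longleftrightarrow>
     (\<forall>x y::'a. \<exists>\<gamma>::real \<Rightarrow> 'a. \<gamma> 0 = x \<and> \<gamma> (dist x y) = y \<and>
        (\<forall>s\<in>{0..dist x y}. \<forall>t\<in>{0..dist x y}. dist (\<gamma> s) (\<gamma> t) = \<bar>s - t\<bar>))"

text \<open>\<^term>\<open>gromov_product x y z\<close> is the product $(y,z)_x$: the base point comes first.\<close>

definition gromov_product :: "'a::metric_space \<Rightarrow> 'a \<Rightarrow> 'a \<Rightarrow> real" where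
  "gromov_product x y z = (dist x y + dist x z - dist y z) / 2"

definition hyperbolic_space :: "real \<Rightarrow> 'a::metric_space itself \<Rightarrow> bool" where
  "hyperbolic_space \<delta> T \<longleftrightarrow> \<delta> \<ge> 0 \<and> geodesic_space T \<and>
     (\<forall>x y z w::'a. gromov_product w x z
        \<ge> min (gromov_product w x y) (gromov_product w y z) - \<delta>)"


section \<open>The Gromov boundary\<close>

text \<open>The notions below take a base point \<open>x\<close>. Boundary points are equivalence classes of
  sequences; in a hyperbolic space neither the sequences nor the classes depend on \<open>x\<close>.
  A sequence \<open>u\<close> converges to the boundary point \<open>z\<close> iff \<open>u \<in> z\<close>.\<close>

definition gromov_seqs :: "'a::metric_space \<Rightarrow> (nat \<Rightarrow> 'a) set" where
  "gromov_seqs x =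
     {u. filterlim (\<lambda>(n, m). gromov_product x (u n) (u m)) at_top (sequentially \<times>\<^sub>F sequentially)}"

definition gromov_rel :: "'a::metric_space \<Rightarrow> ((nat \<Rightarrow> 'a) \<times> (nat \<Rightarrow> 'a)) set" where
  "gromov_rel x = {(u, v). u \<in> gromov_seqs x \<and> v \<in> gromov_seqs x \<and>
     filterlim (\<lambda>(n, m). gromov_product x (u n) (v m)) at_top (sequentially \<times>\<^sub>F sequentially)}"

type_synonym 'a bdry_point = "(nat \<Rightarrow> 'a) set"

definition gromov_boundary :: "'a::metric_space \<Rightarrow> 'a bdry_point set" where
  "gromov_boundary x = gromov_seqs x // gromov_rel x"

definition bdry_product :: "'a::metric_space \<Rightarrow> 'a bdry_point \<Rightarrow> 'a bdry_point \<Rightarrow> ereal" where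
  "bdry_product x z z' =
     (SUP (u, v) \<in> z \<times> z'. Liminf (sequentially \<times>\<^sub>F sequentially)
        (\<lambda>(n, m). ereal (gromov_product x (u n) (v m))))"

definition geodesic_ray :: "(real \<Rightarrow> 'a::metric_space) \<Rightarrow> bool" where
  "geodesic_ray \<xi> \<longleftrightarrow> (\<forall>s\<ge>0. \<forall>t\<ge>0. dist (\<xi> s) (\<xi> t) = \<bar>s - t\<bar>)"

definition ray_endpoint :: "'a::metric_space \<Rightarrow> (real \<Rightarrow> 'a) \<Rightarrow> 'a bdry_point" where
  "ray_endpoint x \<xi> = gromov_rel x `` {\<lambda>n. \<xi> (real n)}"


section \<open>Groups of isometries\<close>

definition isom_group :: "('a::metric_space \<Rightarrow> 'a) monoid" where
  "isom_group = \<lparr>carrier = {g. bij g \<and> (\<forall>x y. dist (g x) (g y) = dist x y)},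
                 monoid.mult = (\<circ>), one = id\<rparr>"

definition discrete_isoms :: "('a::metric_space \<Rightarrow> 'a) set \<Rightarrow> bool" where
  "discrete_isoms \<Gamma> \<longleftrightarrow> (\<forall>x. \<forall>R\<ge>0. finite {g \<in> \<Gamma>. dist x (g x) \<le> R})"

definition isom_orbit :: "('a \<Rightarrow> 'a) set \<Rightarrow> 'a \<Rightarrow> 'a set" where
  "isom_orbit \<Gamma> x = (\<lambda>g. g x) ` \<Gamma>"

definition limit_set :: "'a::metric_space \<Rightarrow> ('a \<Rightarrow> 'a) set \<Rightarrow> 'a bdry_point set" where
  "limit_set x \<Gamma> = {z \<in> gromov_boundary x. \<exists>u. range u \<subseteq> isom_orbit \<Gamma> x \<and> u \<in> z}"

definition non_elementary :: "'a::metric_space \<Rightarrow> ('a \<Rightarrow> 'a) set \<Rightarrow> bool" where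
  "non_elementary x \<Gamma> \<longleftrightarrow> infinite (limit_set x \<Gamma>) \<or> card (limit_set x \<Gamma>) > 2"

text \<open>For a discrete \<open>\<Gamma>\<close> the sets counted here are finite, so \<^const>\<open>card\<close> is meaningful.\<close>

definition critical_exponent :: "'a::metric_space \<Rightarrow> ('a \<Rightarrow> 'a) set \<Rightarrow> ereal" where
  "critical_exponent x \<Gamma> =
     Limsup at_top (\<lambda>T::real. ereal (1 / T * ln (real (card (isom_orbit \<Gamma> x \<inter> ball x T)))))"


section \<open>The ergodic limit set\<close>

definition tau_theta_limit_set ::
  "'a::metric_space \<Rightarrow> ('a \<Rightarrow> 'a) set \<Rightarrow> real \<Rightarrow> (nat \<Rightarrow> real) \<Rightarrow> 'a bdry_point set" where
  "tau_theta_limit_set x \<Gamma> \<tau> \<theta> =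
     {z \<in> gromov_boundary x. \<exists>\<xi>. geodesic_ray \<xi> \<and> \<xi> 0 = x \<and> ray_endpoint x \<xi> = z \<and>
        (\<forall>i. \<exists>y \<in> \<xi> ` {0..}. dist x y \<in> {\<theta> i..\<theta> (Suc i)} \<and> infdist y (isom_orbit \<Gamma> x) \<le> \<tau>)}"

definition theta_erg :: "(nat \<Rightarrow> real) set" where
  "theta_erg = {\<theta>. strict_mono \<theta> \<and> filterlim \<theta> at_top sequentially \<and>
     (\<exists>L>0. (\<lambda>i. \<theta> i / real i) \<longlonglongrightarrow> L)}"

definition ergodic_limit_set :: "'a::metric_space \<Rightarrow> ('a \<Rightarrow> 'a) set \<Rightarrow> 'a bdry_point set" where
  "ergodic_limit_set x \<Gamma> = (\<Union>\<tau>\<in>{0<..}. \<Union>\<theta>\<in>theta_erg. tau_theta_limit_set x \<Gamma> \<tau> \<theta>)"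


section \<open>Visual packing dimension\<close>

definition visual_ball :: "'a::metric_space \<Rightarrow> 'a bdry_point \<Rightarrow> real \<Rightarrow> 'a bdry_point set" where
  "visual_ball x z \<rho> = {z' \<in> gromov_boundary x. bdry_product x z z' > ereal (ln (1 / \<rho>))}"

text \<open>The topology on the boundary in which the visual balls around \<open>z\<close> are the basic
  neighbourhoods of \<open>z\<close> (they need not be open themselves).\<close>

definition bdry_topology :: "'a::metric_space \<Rightarrow> 'a bdry_point topology" where
  "bdry_topology x =
     topology (\<lambda>U. U \<subseteq> gromov_boundary x \<and> (\<forall>z\<in>U. \<exists>\<rho>>0. visual_ball x z \<rho> \<subseteq> U))"

lemma visual_ball_mono:
  assumes "0 < \<rho>" "\<rho> \<le> \<rho>'"
  shows "visual_ball x z \<rho> \<subseteq> visual_ball x z \<rho>'"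
proof -
  have "ln (1 / \<rho>') \<le> ln (1 / \<rho>)"
    using assms by (simp add: ln_div)
  then show ?thesis
    unfolding visual_ball_def by (force intro: le_less_trans[rotated])
qed

lemma openin_bdry_topology:
  "openin (bdry_topology x) U \<longleftrightarrow>
     U \<subseteq> gromov_boundary x \<and> (\<forall>z\<in>U. \<exists>\<rho>>0. visual_ball x z \<rho> \<subseteq> U)"
proof -
  let ?L = "\<lambda>U. U \<subseteq> gromov_boundary x \<and> (\<forall>z\<in>U. \<exists>\<rho>>0. visual_ball x z \<rho> \<subseteq> U)"
  have "istopology ?L"
    unfolding istopology_def
  proof (intro conjI allI impI ballI; (elim conjE)?)
    fix S T z
    assume S: "\<forall>z\<in>S. \<exists>\<rho>>0. visual_ball x z \<rho> \<subseteq> S"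
      and T: "\<forall>z\<in>T. \<exists>\<rho>>0. visual_ball x z \<rho> \<subseteq> T" and z: "z \<in> S \<inter> T"
    obtain \<rho> where \<rho>: "\<rho> > 0" "visual_ball x z \<rho> \<subseteq> S" using S z by blast
    obtain \<rho>' where \<rho>': "\<rho>' > 0" "visual_ball x z \<rho>' \<subseteq> T" using T z by blast
    have "visual_ball x z (min \<rho> \<rho>') \<subseteq> S \<inter> T"
      using \<rho> \<rho>' visual_ball_mono[of "min \<rho> \<rho>'" \<rho> x z] visual_ball_mono[of "min \<rho> \<rho>'" \<rho>' x z]
      by (metis Int_greatest min.cobounded1 min.cobounded2 min_less_iff_conj order_trans)
    then show "\<exists>\<rho>>0. visual_ball x z \<rho> \<subseteq> S \<inter> T"
      using \<rho>(1) \<rho>'(1) by (metis min_less_iff_conj)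
  next
    fix \<K> z assume K: "\<forall>K\<in>\<K>. ?L K" and "z \<in> \<Union>\<K>"
    then obtain A where A: "A \<in> \<K>" "z \<in> A" by blast
    then obtain \<rho> where "\<rho> > 0" "visual_ball x z \<rho> \<subseteq> A" using K by blast
    then show "\<exists>\<rho>>0. visual_ball x z \<rho> \<subseteq> \<Union>\<K>" using A by blast
  qed blast+
  then show ?thesis
    unfolding bdry_topology_def by simp
qed

definition bdry_borel :: "'a::metric_space \<Rightarrow> 'a bdry_point set set" where
  "bdry_borel x = sigma_sets (gromov_boundary x) {U. openin (bdry_topology x) U}"

definition packing_families ::
  "'a::metric_space \<Rightarrow> 'a bdry_point set \<Rightarrow> real
     \<Rightarrow> (nat set \<times> (nat \<Rightarrow> 'a bdry_point) \<times> (nat \<Rightarrow> real)) set" where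
  "packing_families x B \<eta> =
     {(I, z, \<rho>). (\<forall>i\<in>I. z i \<in> B \<and> 0 < \<rho> i \<and> \<rho> i \<le> \<eta>) \<and>
        disjoint_family_on (\<lambda>i. visual_ball x (z i) (\<rho> i)) I}"

definition packing_sup :: "'a::metric_space \<Rightarrow> real \<Rightarrow> 'a bdry_point set \<Rightarrow> real \<Rightarrow> ennreal" where
  "packing_sup x \<alpha> B \<eta> =
     (SUP (I, z, \<rho>) \<in> packing_families x B \<eta>. \<Sum>\<^sub>\<infinity>i\<in>I. ennreal (\<rho> i powr \<alpha>))"

definition packing_premeasure :: "'a::metric_space \<Rightarrow> real \<Rightarrow> 'a bdry_point set \<Rightarrow> ennreal" where
  "packing_premeasure x \<alpha> B = Lim (at_right 0) (packing_sup x \<alpha> B)"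

definition packing_measure :: "'a::metric_space \<Rightarrow> real \<Rightarrow> 'a bdry_point set \<Rightarrow> ennreal" where
  "packing_measure x \<alpha> B =
     (INF C \<in> {C :: nat \<Rightarrow> 'a bdry_point set. range C \<subseteq> bdry_borel x \<and> B \<subseteq> (\<Union>k. C k)}.
        \<Sum>k. packing_premeasure x \<alpha> (C k))"

definition is_packing_dim :: "'a::metric_space \<Rightarrow> 'a bdry_point set \<Rightarrow> ereal \<Rightarrow> bool" where
  "is_packing_dim x B d \<longleftrightarrow> 0 \<le> d \<and>
     (\<forall>\<alpha>\<ge>0. d < ereal \<alpha> \<longrightarrow> packing_measure x \<alpha> B = 0) \<and>
     (\<forall>\<alpha>\<ge>0. ereal \<alpha> < d \<longrightarrow> packing_measure x \<alpha> B = \<infinity>)"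

definition packing_dim :: "'a::metric_space \<Rightarrow> 'a bdry_point set \<Rightarrow> ereal" where
  "packing_dim x B = (THE d. is_packing_dim x B d)"


subsection \<open>The limit and the critical value exist\<close>

lemma packing_sup_mono:
  assumes "\<eta> \<le> \<eta>'"
  shows "packing_sup x \<alpha> B \<eta> \<le> packing_sup x \<alpha> B \<eta>'"
proof -
  have "packing_families x B \<eta> \<subseteq> packing_families x B \<eta>'"
    using assms unfolding packing_families_def by fastforce
  then show ?thesis
    unfolding packing_sup_def by (rule SUP_subset_mono) simp
qed

lemma packing_sup_tendsto:
  "(packing_sup x \<alpha> B \<longlongrightarrow> (INF \<eta>\<in>{0<..}. packing_sup x \<alpha> B \<eta>)) (at_right 0)"
proof (rule decreasing_tendsto)
  show "\<forall>\<^sub>F \<eta> in at_right 0. (INF \<eta>\<in>{0<..}. packing_sup x \<alpha> B \<eta>) \<le> packing_sup x \<alpha> B \<eta>"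
    by (auto simp: eventually_at_right_less intro!: INF_lower eventually_mono[OF eventually_at_right_less])
next
  fix a assume "(INF \<eta>\<in>{0<..}. packing_sup x \<alpha> B \<eta>) < a"
  then obtain \<eta> where \<eta>: "\<eta> > 0" "packing_sup x \<alpha> B \<eta> < a"
    by (auto simp: INF_less_iff)
  have "\<forall>\<^sub>F \<eta>' in at_right 0. \<eta>' < \<eta>"
    using \<eta>(1) by (auto simp: eventually_at_right_field)
  then show "\<forall>\<^sub>F \<eta>' in at_right 0. packing_sup x \<alpha> B \<eta>' < a"
    by eventually_elim (use \<eta>(2) packing_sup_mono le_less_trans less_imp_le in metis)
qed

lemma packing_premeasure_eq_INF:
  "packing_premeasure x \<alpha> B = (INF \<eta>\<in>{0<..}. packing_sup x \<alpha> B \<eta>)"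
  unfolding packing_premeasure_def
  by (rule tendsto_Lim[OF _ packing_sup_tendsto]) simp

lemma packing_sup_exponent:
  assumes "\<alpha> \<le> \<beta>" "\<eta> > 0"
  shows "packing_sup x \<beta> B \<eta> \<le> ennreal (\<eta> powr (\<beta> - \<alpha>)) * packing_sup x \<alpha> B \<eta>"
  unfolding packing_sup_def
proof (rule SUP_least, clarify)
  fix I z \<rho> assume F: "(I, z, \<rho>) \<in> packing_families x B \<eta>"
  then have \<rho>: "0 < \<rho> i" "\<rho> i \<le> \<eta>" if "i \<in> I" for i
    using that by (auto simp: packing_families_def)
  have *: "ennreal (\<rho> i powr \<beta>) \<le> ennreal (\<eta> powr (\<beta> - \<alpha>)) * ennreal (\<rho> i powr \<alpha>)" if "i \<in> I" for i
  proof -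
    have "\<rho> i powr \<beta> = \<rho> i powr (\<beta> - \<alpha>) * \<rho> i powr \<alpha>"
      by (simp add: powr_add[symmetric])
    also have "\<dots> \<le> \<eta> powr (\<beta> - \<alpha>) * \<rho> i powr \<alpha>"
      using \<rho>[OF that] assms by (intro mult_right_mono powr_mono2) auto
    finally show ?thesis
      by (simp add: ennreal_mult[symmetric] ennreal_leI)
  qed
  have "(\<Sum>\<^sub>\<infinity>i\<in>I. ennreal (\<rho> i powr \<beta>))
      = (SUP F\<in>{F. finite F \<and> F \<subseteq> I}. \<Sum>i\<in>F. ennreal (\<rho> i powr \<beta>))"
    by (rule nonneg_infsum_complete) simp
  also have "\<dots> \<le> ennreal (\<eta> powr (\<beta> - \<alpha>)) * (\<Sum>\<^sub>\<infinity>i\<in>I. ennreal (\<rho> i powr \<alpha>))"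
  proof (rule SUP_least)
    fix F assume "F \<in> {F. finite F \<and> F \<subseteq> I}"
    then have F: "finite F" "F \<subseteq> I" by auto
    have "(\<Sum>i\<in>F. ennreal (\<rho> i powr \<beta>))
        \<le> (\<Sum>i\<in>F. ennreal (\<eta> powr (\<beta> - \<alpha>)) * ennreal (\<rho> i powr \<alpha>))"
      using * F(2) by (intro sum_mono) auto
    also have "\<dots> = ennreal (\<eta> powr (\<beta> - \<alpha>)) * (\<Sum>i\<in>F. ennreal (\<rho> i powr \<alpha>))"
      by (rule sum_distrib_left[symmetric])
    also have "\<dots> \<le> ennreal (\<eta> powr (\<beta> - \<alpha>)) * (\<Sum>\<^sub>\<infinity>i\<in>I. ennreal (\<rho> i powr \<alpha>))"
    proof (rule mult_left_mono)
      have "(\<Sum>i\<in>F. ennreal (\<rho> i powr \<alpha>))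
          \<le> (SUP F\<in>{F. finite F \<and> F \<subseteq> I}. \<Sum>i\<in>F. ennreal (\<rho> i powr \<alpha>))"
        using F by (intro SUP_upper) simp
      then show "(\<Sum>i\<in>F. ennreal (\<rho> i powr \<alpha>)) \<le> (\<Sum>\<^sub>\<infinity>i\<in>I. ennreal (\<rho> i powr \<alpha>))"
        by (subst nonneg_infsum_complete) simp_all
    qed simp
    finally show "(\<Sum>i\<in>F. ennreal (\<rho> i powr \<beta>))
        \<le> ennreal (\<eta> powr (\<beta> - \<alpha>)) * (\<Sum>\<^sub>\<infinity>i\<in>I. ennreal (\<rho> i powr \<alpha>))" .
  qed
  also have "\<dots> \<le> ennreal (\<eta> powr (\<beta> - \<alpha>)) *
      (SUP (I, z, \<rho>) \<in> packing_families x B \<eta>. \<Sum>\<^sub>\<infinity>i\<in>I. ennreal (\<rho> i powr \<alpha>))"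
    by (rule mult_left_mono[OF SUP_upper2[OF F]]) auto
  finally show "(\<Sum>\<^sub>\<infinity>i\<in>I. ennreal (\<rho> i powr \<beta>)) \<le> \<dots>" .
qed

lemma packing_premeasure_zero:
  assumes "\<alpha> < \<beta>" "packing_premeasure x \<alpha> B < \<infinity>"
  shows "packing_premeasure x \<beta> B = 0"
proof -
  obtain \<eta>0 where \<eta>0: "\<eta>0 > 0" "packing_sup x \<alpha> B \<eta>0 < \<infinity>"
    using assms(2) by (auto simp: packing_premeasure_eq_INF INF_less_iff)
  let ?M = "packing_sup x \<alpha> B \<eta>0"
  have "((\<lambda>\<eta>::real. \<eta> powr (\<beta> - \<alpha>)) \<longlongrightarrow> 0) (at_right 0)"
  proof -
    have "((\<lambda>\<eta>::real. \<eta> powr (\<beta> - \<alpha>)) \<longlongrightarrow> 0 powr (\<beta> - \<alpha>)) (at_right 0)"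
      using assms(1) by (intro tendsto_powr2 tendsto_intros eventually_mono[OF eventually_at_right_less]) auto
    then show ?thesis by simp
  qed
  then have "((\<lambda>\<eta>::real. ennreal (\<eta> powr (\<beta> - \<alpha>)) * ?M) \<longlongrightarrow> ennreal 0 * ?M) (at_right 0)"
    using \<eta>0(2) by (intro tendsto_mult_ennreal tendsto_ennrealI tendsto_const) auto
  then have lim: "((\<lambda>\<eta>::real. ennreal (\<eta> powr (\<beta> - \<alpha>)) * ?M) \<longlongrightarrow> 0) (at_right 0)"
    by simp
  have "\<forall>\<^sub>F \<eta> in at_right 0. packing_sup x \<beta> B \<eta> \<le> ennreal (\<eta> powr (\<beta> - \<alpha>)) * ?M"
  proof -
    have "\<forall>\<^sub>F \<eta> in at_right 0. 0 < \<eta> \<and> \<eta> < \<eta>0"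
      using \<eta>0(1) by (auto simp: eventually_at_right_field)
    then show ?thesis
    proof eventually_elim
      case (elim \<eta>)
      then have "packing_sup x \<beta> B \<eta> \<le> ennreal (\<eta> powr (\<beta> - \<alpha>)) * packing_sup x \<alpha> B \<eta>"
        using assms(1) by (intro packing_sup_exponent) auto
      also have "\<dots> \<le> ennreal (\<eta> powr (\<beta> - \<alpha>)) * ?M"
        using elim by (intro mult_left_mono packing_sup_mono) auto
      finally show ?case .
    qed
  qed
  then have "(INF \<eta>\<in>{0<..}. packing_sup x \<beta> B \<eta>) \<le> 0"
    by (intro tendsto_le[OF _ lim packing_sup_tendsto]) auto
  then show ?thesis
    by (simp add: packing_premeasure_eq_INF)
qed

lemma packing_measure_zero:
  assumes "\<alpha> < \<beta>" "packing_measure x \<alpha> B < \<infinity>"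
  shows "packing_measure x \<beta> B = 0"
proof -
  obtain C where C: "range C \<subseteq> bdry_borel x" "B \<subseteq> (\<Union>k. C k)"
    "(\<Sum>k. packing_premeasure x \<alpha> (C k)) < \<infinity>"
    using assms(2) by (auto simp: packing_measure_def INF_less_iff)
  have "packing_premeasure x \<alpha> (C k) < \<infinity>" for k
    using C(3) sum_le_suminf[of "\<lambda>k. packing_premeasure x \<alpha> (C k)" "{k}"]
    by (auto intro: le_less_trans)
  then have "packing_premeasure x \<beta> (C k) = 0" for k
    using packing_premeasure_zero[OF assms(1)] by blast
  then have "packing_measure x \<beta> B \<le> 0"
    unfolding packing_measure_def using C(1,2) by (intro INF_lower2[of C]) auto
  then show ?thesis by simp
qed

lemma ex1_packing_dim: "\<exists>!d. is_packing_dim x B d"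
proof (rule ex_ex1I)
  define d where "d = Inf {ereal \<alpha> | \<alpha>. \<alpha> \<ge> 0 \<and> packing_measure x \<alpha> B = 0}"
  have "0 \<le> d" unfolding d_def by (rule Inf_greatest) auto
  moreover have "packing_measure x \<alpha> B = 0" if gt: "d < ereal \<alpha>" for \<alpha>
  proof -
    obtain e where "e \<in> {ereal \<alpha> | \<alpha>. \<alpha> \<ge> 0 \<and> packing_measure x \<alpha> B = 0}" "e < ereal \<alpha>"
      using gt unfolding d_def Inf_less_iff by (elim bexE)
    then obtain \<beta> where "\<beta> < \<alpha>" "packing_measure x \<beta> B = 0"
      by auto
    then show ?thesis using packing_measure_zero[of \<beta> \<alpha> x B] by simp
  qed
  moreover have "packing_measure x \<alpha> B = \<infinity>" if lt: "\<alpha> \<ge> 0" "ereal \<alpha> < d" for \<alpha>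
  proof (rule ccontr)
    assume "packing_measure x \<alpha> B \<noteq> \<infinity>"
    then have fin: "packing_measure x \<alpha> B < \<infinity>" by (simp add: top.not_eq_extremum)
    obtain \<beta> where \<beta>: "ereal \<alpha> < ereal \<beta>" "ereal \<beta> < d"
      using ereal_dense2[OF lt(2)] by blast
    have "packing_measure x \<beta> B = 0"
      using packing_measure_zero[of \<alpha> \<beta>] fin \<beta>(1) by simp
    then have "d \<le> ereal \<beta>"
      unfolding d_def using \<beta>(1) lt(1) by (intro Inf_lower) auto
    then show False using \<beta>(2) by simp
  qed
  ultimately show "\<exists>d. is_packing_dim x B d"
    unfolding is_packing_dim_def by blast
next
  have *: "\<not> d < d'" if d: "is_packing_dim x B d" and d': "is_packing_dim x B d'" for d d'
  proof
    assume "d < d'"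
    then obtain \<alpha> where \<alpha>: "d < ereal \<alpha>" "ereal \<alpha> < d'" using ereal_dense2 by blast
    moreover have "\<alpha> \<ge> 0" 
      using \<alpha>(1) d unfolding is_packing_dim_def by (metis ereal_less_eq(5) le_less_trans less_imp_le)
    ultimately show False using d d' by (auto simp: is_packing_dim_def)
  qed
  then show "d = d'" if "is_packing_dim x B d" "is_packing_dim x B d'" for d d'
    using that by (metis linorder_less_linear)
qed

end

theory Submission
  imports Defs "HOL-Real_Asymp.Real_Asymp"
begin

text \<open>
  Upper bound. Along a ray defining an ergodic limit point, an orbit point is met between times \<open>t\<close>
  and \<open>t / \<kappa> + C\<close> for all \<open>t \<ge> C\<close>, with \<open>\<kappa> < 1\<close> as close to 1 as desired. Choosing \<open>t\<close> slightly above
  \<open>ln (1 / \<rho>\<^sub>i)\<close>, the balls of a packing get distinct orbit points, so that \<open>\<Sum> \<rho>\<^sub>i powr \<alpha>\<close> is bounded by the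
  Poincare series at \<open>\<alpha> \<kappa>\<close>. Passing to closures costs only a constant factor, which takes
  care of the Borel condition.

  Lower bound. Call a set of group elements light if its annuli have at most \<open>C exp (\<alpha> n)\<close>
  elements; finite unions of light sets are light, while \<open>\<Gamma>\<close> is not light for \<open>\<alpha>\<close> below
  the critical exponent. By the pigeonhole principle, elements with \<open>g x\<close> close to a
  boundary point \<open>u\<close> and \<open>g\<^sup>-\<^sup>1 x\<close> close to a boundary point \<open>v\<close> form a non-light set, however close one asks.
  If some \<open>f \<in> \<Gamma>\<close> satisfies \<open>f u \<noteq> v\<close>, the elements \<open>f g\<close> of a long annulus generate a free
  semigroup with at least \<open>exp (\<alpha> D)\<close> generators of length at most \<open>D\<close>. Otherwise \<open>\<Gamma>\<close> fixes \<open>u = v\<close>;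
  conjugating by elements that push \<open>x\<close> towards \<open>u\<close> then shows that, by discreteness, only finitely many elements
  have bounded Busemann shift, so that \<open>\<Gamma>\<close> would have linear growth.
  Infinite words of the semigroup follow rays that meet the orbit at bounded gaps, and
  a Baire category argument on the tree of words shows that any countable cover has a member of
  infinite packing premeasure.
\<close>

section \<open>Gromov products\<close>

abbreviation gp :: "'a::metric_space \<Rightarrow> 'a \<Rightarrow> 'a \<Rightarrow> real" where
  "gp \<equiv> gromov_product"

lemma gp_commute: "gp w p q = gp w q p"
  by (simp add: gromov_product_def dist_commute)

lemma gp_nonneg: "0 \<le> gp w p q"
  using dist_triangle3[of p q w] by (simp add: gromov_product_def dist_commute)

lemma gp_le_dist: "gp w p q \<le> dist w p" "gp w p q \<le> dist w q"
  using dist_triangle[of w q p] dist_triangle[of w p q] by (auto simp: gromov_product_def dist_commute)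

lemma gp_self: "gp w p p = dist w p"
  by (simp add: gromov_product_def)

text \<open>The products at \<open>w\<close> and \<open>p\<close> split the side joining them.
  Below, this is the usual way to turn a small product at one vertex into a large one at the
  other.\<close>

lemma gp_add_gp: "gp w p q + gp p w q = dist w p"
  by (simp add: gromov_product_def dist_commute field_simps)

lemma dist_eq_gp: "dist p q = dist w p + dist w q - 2 * gp w p q"
  by (simp add: gromov_product_def field_simps)

lemma gp_perturb_right: "gp w p q \<le> gp w p q' + dist q q'"
  using dist_triangle[of w q q'] dist_triangle[of p q' q]
  by (simp add: gromov_product_def dist_commute field_simps)

lemma gp_change_base: "gp w p q \<le> gp w' p q + dist w w'"
  using dist_triangle[of w p w'] dist_triangle[of w q w']
  by (simp add: gromov_product_def dist_commute field_simps)

lemma gp_isometry: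
  assumes "\<And>p q. dist (f p) (f q) = dist p q"
  shows "gp (f w) (f p) (f q) = gp w p q"
  by (simp add: gromov_product_def assms)

section \<open>The boundary of a hyperbolic space\<close>

text \<open>The limit along the product filter in explicit form; one threshold serves both
  indices.\<close>

definition gp_to_infinity :: "'a::metric_space \<Rightarrow> (nat \<Rightarrow> 'a) \<Rightarrow> (nat \<Rightarrow> 'a) \<Rightarrow> bool" where
  "gp_to_infinity x u v \<longleftrightarrow> (\<forall>C. \<exists>N. \<forall>n\<ge>N. \<forall>m\<ge>N. C \<le> gp x (u n) (v m))"

lemma filterlim_gp_iff:
  "filterlim (\<lambda>(n, m). gp x (u n) (v m)) at_top (sequentially \<times>\<^sub>F sequentially)
     \<longleftrightarrow> gp_to_infinity x u v"
  unfolding filterlim_at_top eventually_prod_sequentially gp_to_infinity_def by (simp, fast)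

lemma gromov_seqs_iff: "u \<in> gromov_seqs x \<longleftrightarrow> gp_to_infinity x u u"
  by (simp add: gromov_seqs_def filterlim_gp_iff)

lemma gromov_rel_iff:
  "(u, v) \<in> gromov_rel x \<longleftrightarrow> u \<in> gromov_seqs x \<and> v \<in> gromov_seqs x \<and> gp_to_infinity x u v"
  by (simp add: gromov_rel_def filterlim_gp_iff)

lemma gp_to_infinity_sym: "gp_to_infinity x u v \<Longrightarrow> gp_to_infinity x v u"
  unfolding gp_to_infinity_def gp_commute[of x "u _"] by blast

lemma gromov_seqs_dist:
  assumes "u \<in> gromov_seqs x"
  shows "\<exists>N. \<forall>n\<ge>N. C \<le> dist x (u n)"
  using assms unfolding gromov_seqs_iff gp_to_infinity_def gp_self[symmetric] by meson

locale gromov_hyperbolic =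
  fixes x :: "'a::metric_space" and \<delta> :: real
  assumes delta_nonneg: "0 \<le> \<delta>"
    and hyp: "\<And>w p q r :: 'a. min (gp w p q) (gp w q r) - \<delta> \<le> gp w p r"
    and geodesic: "geodesic_space TYPE('a)"
begin

lemma hyp_ge:
  assumes "a \<le> gp w p q" "a \<le> gp w q r"
  shows "a - \<delta> \<le> gp w p (r::'a)"
  using hyp[of w p q r] assms by linarith

lemma hyp_ge4:
  assumes "a \<le> gp w p q" "a \<le> gp w q r" "a \<le> gp w r s"
  shows "a - 2 * \<delta> \<le> gp w p (s::'a)"
  using hyp_ge[OF hyp_ge[OF assms(1,2)], of s] assms(3) delta_nonneg by simp

lemma gp_to_infinity_trans:
  assumes "gp_to_infinity x u v" "gp_to_infinity x v w"
  shows "gp_to_infinity x u w"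
  unfolding gp_to_infinity_def
proof
  fix C
  obtain N M where N: "\<And>n m. n \<ge> N \<Longrightarrow> m \<ge> N \<Longrightarrow> C + \<delta> \<le> gp x (u n) (v m)"
    and M: "\<And>n m. n \<ge> M \<Longrightarrow> m \<ge> M \<Longrightarrow> C + \<delta> \<le> gp x (v n) (w m)"
    using assms unfolding gp_to_infinity_def by metis
  have "C \<le> gp x (u n) (w m)" if "n \<ge> max N M" "m \<ge> max N M" for n m
    using hyp_ge[OF N[of n "max N M"] M[of "max N M" m]] that by simp
  then show "\<exists>N. \<forall>n\<ge>N. \<forall>m\<ge>N. C \<le> gp x (u n) (w m)" by blast
qed

lemma equiv_gromov_rel: "equiv (gromov_seqs x) (gromov_rel x)"
proof (rule equivI)
  show "refl_on (gromov_seqs x) (gromov_rel x)"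
    by (auto simp: refl_on_def gromov_rel_iff gromov_seqs_iff)
  show "sym (gromov_rel x)"
    by (auto simp: sym_def gromov_rel_iff gp_to_infinity_sym)
  show "trans (gromov_rel x)"
    unfolding trans_def gromov_rel_iff using gp_to_infinity_trans by blast
qed (auto simp: gromov_rel_iff)

lemma boundary_nonempty: "z \<in> gromov_boundary x \<Longrightarrow> \<exists>u. u \<in> z"
  unfolding gromov_boundary_def using in_quotient_imp_non_empty[OF equiv_gromov_rel] by blast

lemma boundary_eqI:
  assumes "z \<in> gromov_boundary x" "z' \<in> gromov_boundary x" "u \<in> z" "v \<in> z'" "gp_to_infinity x u v"
  shows "z = z'"
proof -
  have "u \<in> gromov_seqs x" "v \<in> gromov_seqs x"
    using in_quotient_imp_subset[OF equiv_gromov_rel] assms unfolding gromov_boundary_def by auto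
  then have "(u, v) \<in> gromov_rel x" using assms(5) by (simp add: gromov_rel_iff)
  then show ?thesis
    using quotient_eqI[OF equiv_gromov_rel] assms unfolding gromov_boundary_def by blast
qed

lemma boundary_rel:
  assumes "z \<in> gromov_boundary x" "u \<in> z" "v \<in> z"
  shows "gp_to_infinity x u v"
  using quotient_eq_iff[OF equiv_gromov_rel, of z z u v] assms
  unfolding gromov_boundary_def by (auto simp: gromov_rel_iff)

lemma boundary_seqs:
  assumes "z \<in> gromov_boundary x" "u \<in> z"
  shows "u \<in> gromov_seqs x"
  using boundary_rel[OF assms assms(2)] by (simp add: gromov_seqs_iff)

lemma class_in_boundary:
  assumes "u \<in> gromov_seqs x"
  shows "gromov_rel x `` {u} \<in> gromov_boundary x" "u \<in> gromov_rel x `` {u}"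
  using assms quotientI[OF assms, of "gromov_rel x"] equiv_class_self[OF equiv_gromov_rel assms]
  unfolding gromov_boundary_def by auto

section \<open>Gromov products of boundary points and visual balls\<close>

lemma bdry_product_geI:
  assumes "u \<in> z" "v \<in> z'" "\<And>n m. n \<ge> N \<Longrightarrow> m \<ge> N \<Longrightarrow> a \<le> gp x (u n) (v m)"
  shows "ereal a \<le> bdry_product x z z'"
proof -
  have "\<forall>\<^sub>F p in sequentially \<times>\<^sub>F sequentially. ereal a \<le> (\<lambda>(n, m). ereal (gp x (u n) (v m))) p"
    using assms(3) by (auto simp: eventually_prod_sequentially)
  then have "ereal a \<le> Liminf (sequentially \<times>\<^sub>F sequentially) (\<lambda>(n, m). ereal (gp x (u n) (v m)))"
    by (rule Liminf_bounded)
  also have "\<dots> \<le> bdry_product x z z'"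
    unfolding bdry_product_def using assms by (intro SUP_upper2[of "(u, v)"]) auto
  finally show ?thesis .
qed

text \<open>The supremum provides some pair \<open>u'\<close>, \<open>v'\<close> with large
  products. Going from \<open>u\<close> via \<open>u'\<close> and \<open>v'\<close> to
  \<open>v\<close> takes two hyperbolic inequalities, hence the loss 2\<delta> for arbitrary
  representatives.\<close>

lemma bdry_product_greaterD:
  assumes "z \<in> gromov_boundary x" "z' \<in> gromov_boundary x" "ereal a < bdry_product x z z'"
    and "u \<in> z" "v \<in> z'"
  shows "\<exists>N. \<forall>n\<ge>N. \<forall>m\<ge>N. a - 2 * \<delta> \<le> gp x (u n) (v m)"
proof -
  obtain u' v' where uv: "u' \<in> z" "v' \<in> z'"
    "ereal a < Liminf (sequentially \<times>\<^sub>F sequentially) (\<lambda>(n, m). ereal (gp x (u' n) (v' m)))"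
    using assms(3) unfolding bdry_product_def less_SUP_iff by auto
  then obtain N where N: "\<And>n m. n \<ge> N \<Longrightarrow> m \<ge> N \<Longrightarrow> a \<le> gp x (u' n) (v' m)"
    using less_LiminfD[OF uv(3)] by (force simp: eventually_prod_sequentially less_imp_le)
  obtain M where M: "\<And>n m. n \<ge> M \<Longrightarrow> m \<ge> M \<Longrightarrow> a \<le> gp x (u n) (u' m)"
    using boundary_rel[OF assms(1,4) uv(1)] unfolding gp_to_infinity_def by meson
  obtain L where L: "\<And>n m. n \<ge> L \<Longrightarrow> m \<ge> L \<Longrightarrow> a \<le> gp x (v' n) (v m)"
    using boundary_rel[OF assms(2) uv(2) assms(5)] unfolding gp_to_infinity_def by meson
  define K where "K = max N (max M L)"
  have "a - 2 * \<delta> \<le> gp x (u n) (v m)" if "n \<ge> K" "m \<ge> K" for n m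
    using hyp_ge4[OF M[of n K] N[of K K] L[of K m]] that by (simp add: K_def)
  then show ?thesis by blast
qed

text \<open>Of the loss 3\<delta>, passing to fixed representatives costs 2\<delta> and the
  hyperbolic inequality through \<open>v\<close> costs \<delta>.\<close>

lemma bdry_product_ultra:
  assumes "z \<in> gromov_boundary x" "z' \<in> gromov_boundary x" "z'' \<in> gromov_boundary x"
    and "ereal a < bdry_product x z z'" "ereal a < bdry_product x z' z''"
  shows "ereal (a - 3 * \<delta>) \<le> bdry_product x z z''"
proof -
  obtain u v w where uvw: "u \<in> z" "v \<in> z'" "w \<in> z''"
    using boundary_nonempty assms by meson
  obtain N where N: "\<And>n m. n \<ge> N \<Longrightarrow> m \<ge> N \<Longrightarrow> a - 2 * \<delta> \<le> gp x (u n) (v m)"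
    using bdry_product_greaterD[OF assms(1,2,4) uvw(1,2)] by blast
  obtain M where M: "\<And>n m. n \<ge> M \<Longrightarrow> m \<ge> M \<Longrightarrow> a - 2 * \<delta> \<le> gp x (v n) (w m)"
    using bdry_product_greaterD[OF assms(2,3,5) uvw(2,3)] by blast
  show ?thesis
  proof (rule bdry_product_geI[OF uvw(1,3), of "max N M"])
    fix n m assume "n \<ge> max N M" "m \<ge> max N M"
    then show "a - 3 * \<delta> \<le> gp x (u n) (w m)"
      using hyp_ge[OF N[of n "max N M"] M[of "max N M" m]] by simp
  qed
qed

lemma bdry_product_self:
  assumes "z \<in> gromov_boundary x"
  shows "bdry_product x z z = \<infinity>"
proof -
  obtain u where u: "u \<in> z" using boundary_nonempty assms by meson
  have "ereal a \<le> bdry_product x z z" for a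
  proof -
    obtain N where "\<And>n m. n \<ge> N \<Longrightarrow> m \<ge> N \<Longrightarrow> a \<le> gp x (u n) (u m)"
      using boundary_rel[OF assms u u] unfolding gp_to_infinity_def by meson
    then show ?thesis using bdry_product_geI[OF u u] by blast
  qed
  then show ?thesis by (intro ereal_top) 
qed

lemma visual_ball_center:
  "z \<in> gromov_boundary x \<Longrightarrow> z \<in> visual_ball x z \<rho>"
  by (simp add: visual_ball_def bdry_product_self)

text \<open>On the logarithmic scale this factor absorbs the loss 3\<delta> of
  \<open>bdry_product_ultra\<close>; the extra 1 restores the strict inequality in the definition of
  visual balls.\<close>

definition shrink :: real where "shrink = exp (- (3 * \<delta> + 1))"

lemma shrink_pos: "0 < shrink"
  and shrink_le_1: "shrink \<le> 1"
  using delta_nonneg by (auto simp: shrink_def)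

lemma ln_shrink: "0 < \<rho> \<Longrightarrow> ln (1 / (shrink * \<rho>)) = ln (1 / \<rho>) + 3 * \<delta> + 1"
  using shrink_pos by (simp add: ln_div ln_mult) (simp add: shrink_def)

lemma visual_ball_recenter:
  assumes "z \<in> gromov_boundary x" "0 < \<rho>" "z' \<in> visual_ball x z (shrink * \<rho>)"
  shows "visual_ball x z' (shrink * \<rho>) \<subseteq> visual_ball x z \<rho>"
proof
  fix w assume w: "w \<in> visual_ball x z' (shrink * \<rho>)"
  let ?a = "ln (1 / \<rho>) + 3 * \<delta> + 1"
  have "ereal (?a - 3 * \<delta>) \<le> bdry_product x z w"
    using assms w ln_shrink[OF assms(2)]
    by (intro bdry_product_ultra[of z z']) (auto simp: visual_ball_def)
  then have "ereal (ln (1 / \<rho>)) < bdry_product x z w"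
    by (rule less_le_trans[rotated]) simp
  then show "w \<in> visual_ball x z \<rho>" using w by (simp add: visual_ball_def)
qed

text \<open>Used contrapositively, to separate visual balls around limits of diverging paths. Both
  sequences are compared with one that represents the common point \<open>w\<close>.\<close>

lemma visual_balls_meet:
  assumes "z \<in> gromov_boundary x" "z' \<in> gromov_boundary x"
    and "w \<in> visual_ball x z \<rho>" "w \<in> visual_ball x z' \<rho>" "u \<in> z" "v \<in> z'"
  shows "\<exists>N. \<forall>n\<ge>N. \<forall>m\<ge>N. ln (1 / \<rho>) - 3 * \<delta> \<le> gp x (u n) (v m)"
proof -
  let ?a = "ln (1 / \<rho>)"
  have w: "w \<in> gromov_boundary x" "ereal ?a < bdry_product x z w" "ereal ?a < bdry_product x z' w"
    using assms by (auto simp: visual_ball_def)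
  obtain t where t: "t \<in> w" using boundary_nonempty w by meson
  obtain N where N: "\<And>n m. n \<ge> N \<Longrightarrow> m \<ge> N \<Longrightarrow> ?a - 2 * \<delta> \<le> gp x (u n) (t m)"
    using bdry_product_greaterD[OF assms(1) w(1,2) assms(5) t] by blast
  obtain M where M: "\<And>n m. n \<ge> M \<Longrightarrow> m \<ge> M \<Longrightarrow> ?a - 2 * \<delta> \<le> gp x (t n) (v m)"
    using bdry_product_greaterD[OF assms(2) w(1,3) assms(6) t] gp_commute by metis
  have "?a - 3 * \<delta> \<le> gp x (u n) (v m)" if "n \<ge> max N M" "m \<ge> max N M" for n m
    using hyp_ge[OF N[of n "max N M"] M[of "max N M" m]] that by simp
  then show ?thesis by blast
qed

end

section \<open>Packing premeasures\<close>

text \<open>Subfamilies of packings are packings and infinite sums are suprema of finite ones, so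
  finite families suffice.\<close>

lemma packing_sup_leI:
  assumes "\<And>I z \<rho>. (I, z, \<rho>) \<in> packing_families x B \<eta> \<Longrightarrow> finite I \<Longrightarrow> (\<Sum>i\<in>I. ennreal (\<rho> i powr \<alpha>)) \<le> M"
  shows "packing_sup x \<alpha> B \<eta> \<le> M"
  unfolding packing_sup_def
proof (rule SUP_least, clarify)
  fix I z \<rho> assume F: "(I, z, \<rho>) \<in> packing_families x B \<eta>"
  have "(\<Sum>i\<in>J. ennreal (\<rho> i powr \<alpha>)) \<le> M" if "finite J" "J \<subseteq> I" for J
  proof (rule assms)
    show "(J, z, \<rho>) \<in> packing_families x B \<eta>"
      using F that disjoint_family_on_mono[of J I] by (auto simp: packing_families_def)
  qed fact
  then have "(SUP J\<in>{J. finite J \<and> J \<subseteq> I}. \<Sum>i\<in>J. ennreal (\<rho> i powr \<alpha>)) \<le> M"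
    by (intro SUP_least) auto
  then show "(\<Sum>\<^sub>\<infinity>i\<in>I. ennreal (\<rho> i powr \<alpha>)) \<le> M"
    by (simp add: nonneg_infsum_complete)
qed

lemma packing_sup_geI:
  assumes "(I, z, \<rho>) \<in> packing_families x B \<eta>" "finite I"
  shows "(\<Sum>i\<in>I. ennreal (\<rho> i powr \<alpha>)) \<le> packing_sup x \<alpha> B \<eta>"
  unfolding packing_sup_def using assms by (intro SUP_upper2[OF assms(1)]) auto

lemma packing_premeasure_le_sup:
  "0 < \<eta> \<Longrightarrow> packing_premeasure x \<alpha> B \<le> packing_sup x \<alpha> B \<eta>"
  unfolding packing_premeasure_eq_INF by (rule INF_lower) simp

context gromov_hyperbolic
begin

section \<open>Closures as Borel covers\<close>

definition bdry_closure :: "'a bdry_point set \<Rightarrow> 'a bdry_point set" where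
  "bdry_closure A = {z \<in> gromov_boundary x. \<forall>\<rho>>0. visual_ball x z \<rho> \<inter> A \<noteq> {}}"

lemma subset_bdry_closure: "A \<subseteq> gromov_boundary x \<Longrightarrow> A \<subseteq> bdry_closure A"
  using visual_ball_center by (fastforce simp: bdry_closure_def)

text \<open>The complement is open: if a ball around \<open>z\<close> misses \<open>A\<close>, then
  by \<open>visual_ball_recenter\<close> every point of the shrunken ball has a ball that misses
  \<open>A\<close> as well.\<close>

lemma bdry_closure_borel: "bdry_closure A \<in> bdry_borel x"
proof -
  let ?U = "gromov_boundary x - bdry_closure A"
  have "\<exists>\<rho>>0. visual_ball x z \<rho> \<subseteq> ?U" if z: "z \<in> ?U" for z
  proof -
    obtain \<rho> where \<rho>: "\<rho> > 0" "visual_ball x z \<rho> \<inter> A = {}"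
      using z by (auto simp: bdry_closure_def)
    have "w \<in> ?U" if w: "w \<in> visual_ball x z (shrink * \<rho>)" for w
    proof -
      have "visual_ball x w (shrink * \<rho>) \<inter> A = {}"
        using visual_ball_recenter[OF _ \<rho>(1) w] z \<rho>(2) by blast
      then show ?thesis
        using w \<rho>(1) shrink_pos by (auto simp: bdry_closure_def visual_ball_def intro!: exI[of _ "shrink * \<rho>"])
    qed
    then show ?thesis using \<rho>(1) shrink_pos by (intro exI[of _ "shrink * \<rho>"]) auto
  qed
  then have "openin (bdry_topology x) ?U"
    unfolding openin_bdry_topology by blast
  then have "gromov_boundary x - ?U \<in> bdry_borel x"
    unfolding bdry_borel_def by (intro sigma_sets.Compl sigma_sets.Basic) simp
  moreover have "gromov_boundary x - ?U = bdry_closure A" by (auto simp: bdry_closure_def)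
  ultimately show ?thesis by simp
qed

text \<open>Each centre is moved to a point of \<open>A\<close> in the ball shrunk by
  \<open>shrink\<close>. The new ball of the shrunken radius lies in the old one, so disjointness
  persists and the radii change by a constant factor only.\<close>

lemma packing_sup_closure:
  assumes "0 \<le> \<alpha>"
  shows "packing_sup x \<alpha> (bdry_closure A) \<eta> \<le> ennreal (shrink powr (- \<alpha>)) * packing_sup x \<alpha> A \<eta>"
proof (rule packing_sup_leI)
  fix I z \<rho> assume F: "(I, z, \<rho>) \<in> packing_families x (bdry_closure A) \<eta>" and fin: "finite I"
  have z: "z i \<in> bdry_closure A" "0 < \<rho> i" "\<rho> i \<le> \<eta>" if "i \<in> I" for i
    using F that by (auto simp: packing_families_def)
  have "\<exists>z'. z' \<in> visual_ball x (z i) (shrink * \<rho> i) \<inter> A" if "i \<in> I" for i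
  proof -
    have "0 < shrink * \<rho> i" using z(2)[OF that] shrink_pos by simp
    then show ?thesis using z(1)[OF that] unfolding bdry_closure_def by blast
  qed
  then obtain z' where z': "\<And>i. i \<in> I \<Longrightarrow> z' i \<in> visual_ball x (z i) (shrink * \<rho> i)"
    "\<And>i. i \<in> I \<Longrightarrow> z' i \<in> A"
    by (metis Int_iff)
  have sub: "visual_ball x (z' i) (shrink * \<rho> i) \<subseteq> visual_ball x (z i) (\<rho> i)" if "i \<in> I" for i
    using visual_ball_recenter z[OF that] z'[OF that] by (auto simp: bdry_closure_def)
  have "shrink * \<rho> i \<le> \<eta>" if "i \<in> I" for i
    using z[OF that] shrink_le_1 mult_right_mono[of shrink 1 "\<rho> i"] by linarith
  then have "(I, z', \<lambda>i. shrink * \<rho> i) \<in> packing_families x A \<eta>"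
    unfolding packing_families_def
  proof (clarify, intro conjI ballI)
    show "disjoint_family_on (\<lambda>i. visual_ball x (z' i) (shrink * \<rho> i)) I"
      using F sub unfolding packing_families_def disjoint_family_on_def by blast
  qed (use z z' shrink_pos in auto)
  then have *: "(\<Sum>i\<in>I. ennreal ((shrink * \<rho> i) powr \<alpha>)) \<le> packing_sup x \<alpha> A \<eta>"
    using fin by (rule packing_sup_geI)
  have "\<rho> i powr \<alpha> = shrink powr (- \<alpha>) * (shrink * \<rho> i) powr \<alpha>" if "i \<in> I" for i
    using z[OF that] shrink_pos by (simp add: powr_mult powr_minus field_simps)
  then have "(\<Sum>i\<in>I. ennreal (\<rho> i powr \<alpha>)) = (\<Sum>i\<in>I. ennreal (shrink powr (- \<alpha>)) * ennreal ((shrink * \<rho> i) powr \<alpha>))"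
    by (intro sum.cong) (auto simp: ennreal_mult[symmetric])
  also have "\<dots> = ennreal (shrink powr (- \<alpha>)) * (\<Sum>i\<in>I. ennreal ((shrink * \<rho> i) powr \<alpha>))"
    by (rule sum_distrib_left[symmetric])
  also have "\<dots> \<le> ennreal (shrink powr (- \<alpha>)) * packing_sup x \<alpha> A \<eta>"
    using * by (intro mult_left_mono) auto
  finally show "(\<Sum>i\<in>I. ennreal (\<rho> i powr \<alpha>)) \<le> \<dots>" .
qed

lemma packing_premeasure_closure_finite:
  assumes "0 \<le> \<alpha>" "packing_premeasure x \<alpha> A < \<infinity>"
  shows "packing_premeasure x \<alpha> (bdry_closure A) < \<infinity>"
proof -
  obtain \<eta> where \<eta>: "\<eta> > 0" "packing_sup x \<alpha> A \<eta> < \<infinity>"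
    using assms(2) by (auto simp: packing_premeasure_eq_INF INF_less_iff)
  have "packing_premeasure x \<alpha> (bdry_closure A) \<le> ennreal (shrink powr (- \<alpha>)) * packing_sup x \<alpha> A \<eta>"
    using packing_premeasure_le_sup[OF \<eta>(1)] packing_sup_closure[OF assms(1)] by (rule order_trans)
  also have "\<dots> < \<infinity>" using \<eta>(2) by (simp add: ennreal_mult_less_top)
  finally show ?thesis .
qed

text \<open>The closures of the \<open>A k\<close> form a Borel cover with finite premeasures at
  \<alpha>, and these vanish at the larger exponent \<beta>.\<close>

lemma packing_measure_zeroI:
  fixes A :: "nat \<Rightarrow> 'a bdry_point set"
  assumes "0 \<le> \<alpha>" "\<alpha> < \<beta>" "B \<subseteq> (\<Union>k. A k)"
    and "\<And>k. A k \<subseteq> gromov_boundary x" "\<And>k. packing_premeasure x \<alpha> (A k) < \<infinity>"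
  shows "packing_measure x \<beta> B = 0"
proof -
  let ?C = "\<lambda>k. bdry_closure (A k)"
  have "packing_premeasure x \<beta> (?C k) = 0" for k
    by (rule packing_premeasure_zero[OF assms(2) packing_premeasure_closure_finite[OF assms(1,5)]])
  moreover have "B \<subseteq> (\<Union>k. ?C k)"
    by (rule order_trans[OF assms(3)], rule UN_mono) (auto intro: subset_bdry_closure[THEN subsetD] assms(4)[THEN subsetD])
  ultimately have "packing_measure x \<beta> B \<le> 0"
    unfolding packing_measure_def using bdry_closure_borel by (intro INF_lower2[of ?C]) auto
  then show ?thesis by simp
qed

section \<open>The upper bound\<close>

lemma gp_ray:
  assumes "geodesic_ray \<xi>" "\<xi> 0 = x" "0 \<le> s" "0 \<le> t"
  shows "gp x (\<xi> s) (\<xi> t) = min s t"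
proof -
  have "dist x (\<xi> s) = s" "dist x (\<xi> t) = t" "dist (\<xi> s) (\<xi> t) = \<bar>s - t\<bar>"
    using assms unfolding geodesic_ray_def by (metis abs_of_nonneg diff_0 abs_minus_cancel order_refl)+
  then show ?thesis by (simp add: gromov_product_def min_def abs_if)
qed

lemma dist_ray:
  assumes "geodesic_ray \<xi>" "\<xi> 0 = x" "0 \<le> s"
  shows "dist x (\<xi> s) = s"
  using gp_ray[OF assms assms(3)] by (simp add: gp_self)

lemma ray_gromov_seq:
  assumes "geodesic_ray \<xi>" "\<xi> 0 = x"
  shows "(\<lambda>n. \<xi> (real n)) \<in> gromov_seqs x"
  unfolding gromov_seqs_iff gp_to_infinity_def
proof
  fix C :: real
  obtain N :: nat where "C \<le> real N" using real_arch_simple by blast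
  then show "\<exists>N. \<forall>n\<ge>N. \<forall>m\<ge>N. C \<le> gp x (\<xi> (real n)) (\<xi> (real m))"
    using gp_ray[OF assms] by (intro exI[of _ N]) auto
qed

lemma ray_endpoint_boundary:
  assumes "geodesic_ray \<xi>" "\<xi> 0 = x"
  shows "ray_endpoint x \<xi> \<in> gromov_boundary x" "(\<lambda>n. \<xi> (real n)) \<in> ray_endpoint x \<xi>"
  using class_in_boundary[OF ray_gromov_seq[OF assms]] by (simp_all add: ray_endpoint_def)

text \<open>One constant \<open>C\<close> serves as starting time, as slack in time and as distance
  to \<open>Y\<close>, so that the sets with natural \<open>C\<close> form a countable cover of the
  ergodic limit set.\<close>

definition radial_set :: "'a set \<Rightarrow> real \<Rightarrow> real \<Rightarrow> 'a bdry_point set" where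
  "radial_set Y \<kappa> C = {z \<in> gromov_boundary x. \<exists>\<xi>. geodesic_ray \<xi> \<and> \<xi> 0 = x \<and> ray_endpoint x \<xi> = z \<and>
     (\<forall>t\<ge>C. \<exists>s. t \<le> s \<and> s \<le> t / \<kappa> + C \<and> (\<exists>p\<in>Y. dist (\<xi> s) p \<le> C))}"

text \<open>Far points of either ray have product at least \<open>t - C\<close> with
  \<open>p\<close>, because the ray passes within \<open>C\<close> of \<open>p\<close> after time
  \<open>t\<close>. A hyperbolic inequality through \<open>p\<close> joins the two rays.\<close>

lemma common_shadow:
  assumes \<xi>: "geodesic_ray \<xi>" "\<xi> 0 = x" "t \<le> s" "dist (\<xi> s) p \<le> C"
    and \<xi>': "geodesic_ray \<xi>'" "\<xi>' 0 = x" "t \<le> s'" "dist (\<xi>' s') p \<le> C" and "0 \<le> t"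
  shows "ereal (t - C - \<delta>) \<le> bdry_product x (ray_endpoint x \<xi>) (ray_endpoint x \<xi>')"
proof -
  have *: "t - C \<le> gp x (\<zeta> (real n)) p"
    if "geodesic_ray \<zeta>" "\<zeta> 0 = x" "t \<le> r" "dist (\<zeta> r) p \<le> C" "r \<le> real n" for \<zeta> r n
    using gp_ray[of \<zeta> "real n" r] gp_perturb_right[of x "\<zeta> (real n)" "\<zeta> r" p] that \<open>0 \<le> t\<close> by auto
  obtain N :: nat where N: "s \<le> real N" "s' \<le> real N"
    by (meson max.bounded_iff real_arch_simple)
  show ?thesis
  proof (rule bdry_product_geI[OF ray_endpoint_boundary(2)[OF \<xi>(1,2)] ray_endpoint_boundary(2)[OF \<xi>'(1,2)], of N])
    fix n m assume "n \<ge> N" "m \<ge> N"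
    then have "s \<le> real n" "s' \<le> real m" using N by (meson of_nat_mono order_trans)+
    then show "t - C - \<delta> \<le> gp x (\<xi> (real n)) (\<xi>' (real m))"
      using *[OF \<xi>] *[OF \<xi>'] by (intro hyp_ge[of _ _ _ p]) (auto simp: gp_commute[of x p])
  qed
qed

lemma packing_premeasure_radial_set:
  assumes "0 \<le> \<alpha>" "0 < \<kappa>" "0 \<le> C"
    and P: "\<And>F. finite F \<Longrightarrow> F \<subseteq> Y \<Longrightarrow> (\<Sum>p\<in>F. exp (- (\<alpha> * \<kappa>) * dist x p)) \<le> P"
  shows "packing_premeasure x \<alpha> (radial_set Y \<kappa> C) < \<infinity>"
proof -
  \<comment> \<open>Collects the constants in the estimate
    \<open>ln (\<rho> i) \<le> E - \<kappa> * dist x (p i)\<close> proved below.\<close>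
  define E where "E = 2 * C + \<delta> + 1 + 2 * C * \<kappa>"
  have "packing_sup x \<alpha> (radial_set Y \<kappa> C) 1 \<le> ennreal (exp (\<alpha> * E) * P)"
  proof (rule packing_sup_leI)
    fix I z \<rho> assume F: "(I, z, \<rho>) \<in> packing_families x (radial_set Y \<kappa> C) 1" and fin: "finite I"
    then have z: "z i \<in> radial_set Y \<kappa> C" "0 < \<rho> i" "\<rho> i \<le> 1" if "i \<in> I" for i
      using that by (auto simp: packing_families_def)
    have zb: "z i \<in> gromov_boundary x" if "i \<in> I" for i
      using z(1)[OF that] by (auto simp: radial_set_def)
    have disj: "visual_ball x (z i) (\<rho> i) \<inter> visual_ball x (z j) (\<rho> j) = {}" if "i \<in> I" "j \<in> I" "i \<noteq> j" for i j
      using F that by (auto simp: packing_families_def disjoint_family_on_def)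
    \<comment> \<open>Deep enough that a common orbit point forces a product of at least
      \<open>t i - C - \<delta>\<close>, which exceeds \<open>ln (1 / \<rho> i)\<close>; also at
      least \<open>C\<close>, so that the property defining \<open>radial_set\<close>
      applies.\<close>
    define t where "t i = ln (1 / \<rho> i) + 2 * C + \<delta> + 1" for i
    have ln_nn: "0 \<le> ln (1 / \<rho> i)" if "i \<in> I" for i
      using z(2,3)[OF that] by (intro ln_ge_zero) auto
    have t: "C \<le> t i" "0 \<le> t i" if "i \<in> I" for i
      using ln_nn[OF that] assms delta_nonneg by (auto simp: t_def)
    have "\<forall>i\<in>I. \<exists>\<xi> s p. geodesic_ray \<xi> \<and> \<xi> 0 = x \<and> ray_endpoint x \<xi> = z i \<and> t i \<le> s \<and> s \<le> t i / \<kappa> + C \<and>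
        p \<in> Y \<and> dist (\<xi> s) p \<le> C"
      using z(1) t(1) unfolding radial_set_def by blast
    then obtain \<xi> s p where *: "\<forall>i\<in>I. geodesic_ray (\<xi> i) \<and> \<xi> i 0 = x \<and> ray_endpoint x (\<xi> i) = z i \<and>
        t i \<le> s i \<and> s i \<le> t i / \<kappa> + C \<and> p i \<in> Y \<and> dist (\<xi> i (s i)) (p i) \<le> C"
      unfolding bchoice_iff by blast
    then have \<xi>: "\<And>i. i \<in> I \<Longrightarrow> geodesic_ray (\<xi> i)" "\<And>i. i \<in> I \<Longrightarrow> \<xi> i 0 = x"
      "\<And>i. i \<in> I \<Longrightarrow> ray_endpoint x (\<xi> i) = z i" and s: "\<And>i. i \<in> I \<Longrightarrow> t i \<le> s i"
      "\<And>i. i \<in> I \<Longrightarrow> s i \<le> t i / \<kappa> + C" and p: "\<And>i. i \<in> I \<Longrightarrow> p i \<in> Y"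
      "\<And>i. i \<in> I \<Longrightarrow> dist (\<xi> i (s i)) (p i) \<le> C"
      by blast+
    \<comment> \<open>A shared orbit point would put the centre of the smaller ball into the larger
      ball.\<close>
    have ne: "p i \<noteq> p j" if ij: "i \<in> I" "j \<in> I" "i \<noteq> j" "\<rho> j \<le> \<rho> i" for i j
    proof
      assume eq: "p i = p j"
      have "t i \<le> t j" using ij(4) z(2)[OF ij(1)] z(2)[OF ij(2)] by (simp add: t_def ln_div)
      then have "ereal (t i - C - \<delta>) \<le> bdry_product x (z i) (z j)"
        using common_shadow[OF \<xi>(1,2)[OF ij(1)] s(1)[OF ij(1)] p(2)[OF ij(1)] \<xi>(1,2)[OF ij(2)] _ _ t(2)[OF ij(1)], of "s j"]
          order_trans[OF _ s(1)[OF ij(2)]] p(2)[OF ij(2)] by (simp add: \<xi>(3)[OF ij(1)] \<xi>(3)[OF ij(2)] eq)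
      moreover have "ln (1 / \<rho> i) < t i - C - \<delta>" using assms by (simp add: t_def)
      ultimately have "ereal (ln (1 / \<rho> i)) < bdry_product x (z i) (z j)"
        by (metis less_ereal.simps(1) less_le_trans)
      then have "z j \<in> visual_ball x (z i) (\<rho> i)"
        using zb[OF ij(2)] by (simp add: visual_ball_def)
      then show False using disj[OF ij(1-3)] visual_ball_center[OF zb[OF ij(2)]] by blast
    qed
    have inj: "inj_on p I"
      by (rule inj_onI) (metis ne linear)
    have bound: "\<rho> i powr \<alpha> \<le> exp (\<alpha> * E) * exp (- (\<alpha> * \<kappa>) * dist x (p i))" if i: "i \<in> I" for i
    proof -
      have "dist x (p i) \<le> dist x (\<xi> i (s i)) + dist (\<xi> i (s i)) (p i)" by (rule dist_triangle)
      also have "\<dots> \<le> t i / \<kappa> + C + C"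
        using dist_ray[OF \<xi>(1,2)[OF i]] s[OF i] p(2)[OF i] t(2)[OF i] by auto
      finally have "\<kappa> * dist x (p i) \<le> t i + 2 * C * \<kappa>"
        using assms(2) by (simp add: field_simps)
      then have "ln (\<rho> i) \<le> E - \<kappa> * dist x (p i)"
        using z(2)[OF i] by (simp add: t_def E_def ln_div)
      from mult_left_mono[OF this assms(1)]
      have "\<alpha> * ln (\<rho> i) \<le> \<alpha> * E + - (\<alpha> * \<kappa>) * dist x (p i)"
        by (simp add: right_diff_distrib mult.assoc)
      then have "exp (\<alpha> * ln (\<rho> i)) \<le> exp (\<alpha> * E + - (\<alpha> * \<kappa>) * dist x (p i))"
        by (simp only: exp_le_cancel_iff)
      then show ?thesis unfolding exp_add using z(2)[OF i] by (simp add: powr_def)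
    qed
    have "(\<Sum>i\<in>I. \<rho> i powr \<alpha>) \<le> (\<Sum>i\<in>I. exp (\<alpha> * E) * exp (- (\<alpha> * \<kappa>) * dist x (p i)))"
      by (rule sum_mono) (rule bound)
    also have "\<dots> = exp (\<alpha> * E) * (\<Sum>q\<in>p ` I. exp (- (\<alpha> * \<kappa>) * dist x q))"
      by (simp add: sum.reindex[OF inj] sum_distrib_left)
    also have "\<dots> \<le> exp (\<alpha> * E) * P"
      using P[of "p ` I"] fin p(1) by (intro mult_left_mono) auto
    finally have "ennreal (\<Sum>i\<in>I. \<rho> i powr \<alpha>) \<le> ennreal (exp (\<alpha> * E) * P)"
      by (rule ennreal_leI)
    then show "(\<Sum>i\<in>I. ennreal (\<rho> i powr \<alpha>)) \<le> ennreal (exp (\<alpha> * E) * P)"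
      by (simp add: sum_ennreal)
  qed
  then have "packing_premeasure x \<alpha> (radial_set Y \<kappa> C) \<le> ennreal (exp (\<alpha> * E) * P)"
    using packing_premeasure_le_sup[of 1] by (meson order_trans zero_less_one)
  also have "\<dots> < \<infinity>" by simp
  finally show ?thesis .
qed

lemma ergodic_subset_radial:
  assumes z: "z \<in> tau_theta_limit_set x \<Gamma> \<tau> \<theta>" and \<theta>: "\<theta> \<in> theta_erg" and "0 < \<tau>" and \<kappa>: "0 < \<kappa>" "\<kappa> < 1"
    and "\<Gamma> \<noteq> {}"
  shows "\<exists>C::nat. z \<in> radial_set (isom_orbit \<Gamma> x) \<kappa> (real C)"
proof -
  let ?Y = "isom_orbit \<Gamma> x"
  obtain L where mono: "strict_mono \<theta>" and top: "filterlim \<theta> at_top sequentially"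
    and L: "L > 0" "(\<lambda>i. \<theta> i / real i) \<longlonglongrightarrow> L"
    using \<theta> by (auto simp: theta_erg_def)
  obtain \<xi> where \<xi>: "geodesic_ray \<xi>" "\<xi> 0 = x" "ray_endpoint x \<xi> = z"
    and y: "\<And>i. \<exists>y \<in> \<xi> ` {0..}. dist x y \<in> {\<theta> i..\<theta> (Suc i)} \<and> infdist y ?Y \<le> \<tau>"
    using z by (auto simp: tau_theta_limit_set_def)
  \<comment> \<open>This is \<open>\<theta> (i + 2) / \<theta> i\<close> expressed through the
    convergent ratios, so it tends to 1. The shift by 2 covers the predecessor of the chosen index
    and the right end of its interval.\<close>
  have "(\<lambda>i. (\<theta> (i + 2) / real (i + 2)) * (1 + 2 / real i) / (\<theta> i / real i)) \<longlonglongrightarrow> L * (1 + 0) / L"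
    by (intro tendsto_intros LIMSEQ_ignore_initial_segment L lim_const_over_n) (use L in auto)
  then have "\<forall>\<^sub>F i in sequentially. (\<theta> (i + 2) / real (i + 2)) * (1 + 2 / real i) / (\<theta> i / real i) < 1 / \<kappa>"
    using L \<kappa> by (intro order_tendstoD(2)) (auto simp: field_simps)
  moreover have "\<forall>\<^sub>F i in sequentially. 0 < \<theta> i"
    using top by (simp add: filterlim_at_top_dense)
  moreover have "\<forall>\<^sub>F i in sequentially. 0 < i" by (rule eventually_gt_at_top)
  ultimately have "\<forall>\<^sub>F i in sequentially. \<theta> (i + 2) \<le> \<theta> i / \<kappa>"
  proof eventually_elim
    case (elim i)
    have "(\<theta> (i + 2) / real (i + 2)) * (1 + 2 / real i) / (\<theta> i / real i) = \<theta> (i + 2) / \<theta> i"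
    proof -
      have "1 + 2 / real i = real (i + 2) / real i" using elim by (simp add: field_simps)
      then show ?thesis using elim by (simp del: of_nat_add)
    qed
    then have "\<theta> (i + 2) / \<theta> i < 1 / \<kappa>" using elim(1) by metis
    then show ?case using elim(2) \<kappa> by (simp add: field_simps)
  qed
  then obtain N where N: "\<And>i. i \<ge> N \<Longrightarrow> \<theta> (i + 2) \<le> \<theta> i / \<kappa>"
    by (auto simp: eventually_sequentially)
  \<comment> \<open>The bound \<open>\<theta> (Suc N)\<close> forces the index chosen below past
    \<open>N\<close>; \<open>\<tau> + 1\<close> leaves room for approximating the infimum that
    defines \<open>infdist\<close>.\<close>
  obtain C :: nat where C: "max (\<theta> (Suc N)) (\<tau> + 1) \<le> real C"
    using real_arch_simple by blast
  have "\<exists>s. t \<le> s \<and> s \<le> t / \<kappa> + real C \<and> (\<exists>p\<in>?Y. dist (\<xi> s) p \<le> real C)" if t: "t \<ge> real C" for t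
  proof -
    have ex: "\<exists>i. t \<le> \<theta> i" 
      using top unfolding filterlim_at_top eventually_sequentially by (meson order_refl)
    \<comment> \<open>The predecessor \<open>j\<close> of this first index has
      \<open>\<theta> j < t\<close>, so the point near the orbit comes before time \<open>\<theta>
      (j + 2) \<le> \<theta> j / \<kappa> \<le> t / \<kappa>\<close>.\<close>
    define i where "i = (LEAST i. t \<le> \<theta> i)"
    have i: "t \<le> \<theta> i" "\<And>j. j < i \<Longrightarrow> \<theta> j < t"
      using LeastI_ex[OF ex] not_less_Least unfolding i_def by (auto simp: not_le[symmetric])
    have "\<not> i \<le> N"
    proof
      assume "i \<le> N"
      then have "\<theta> i < \<theta> (Suc N)" using mono by (auto simp: strict_mono_def)
      then show False using i(1) C t by simp
    qed
    then obtain j where j: "i = Suc j" "j \<ge> N" by (cases i) auto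
    obtain s where s: "0 \<le> s" "dist x (\<xi> s) \<in> {\<theta> i..\<theta> (Suc i)}" "infdist (\<xi> s) ?Y \<le> \<tau>"
      using y[of i] by auto
    have ds: "dist x (\<xi> s) = s" using dist_ray[OF \<xi>(1,2) s(1)] .
    have "s \<le> \<theta> (j + 2)" using s ds j by simp
    also have "\<dots> \<le> \<theta> j / \<kappa>" by (rule N[OF j(2)])
    also have "\<dots> \<le> t / \<kappa>" using i(2)[of j] j \<kappa> by (intro divide_right_mono) auto
    finally have "s \<le> t / \<kappa> + real C" by simp
    moreover have "t \<le> s" using i(1) s ds by simp
    moreover have "\<exists>p\<in>?Y. dist (\<xi> s) p \<le> real C"
    proof -
      have ne: "?Y \<noteq> {}" using \<open>\<Gamma> \<noteq> {}\<close> by (simp add: isom_orbit_def)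
      have "(INF p\<in>?Y. dist (\<xi> s) p) < \<tau> + 1" using s(3) ne by (simp add: infdist_def)
      then obtain p where "p \<in> ?Y" "dist (\<xi> s) p < \<tau> + 1"
        using ne by (subst (asm) cINF_less_iff) auto
      then show ?thesis using C by (intro bexI[of _ p]) auto
    qed
    ultimately show ?thesis by blast
  qed
  then have "z \<in> radial_set ?Y \<kappa> (real C)"
    using \<xi> ray_endpoint_boundary(1)[OF \<xi>(1,2)] unfolding radial_set_def by blast
  then show ?thesis by blast
qed

end

section \<open>Discrete groups of isometries\<close>

text \<open>Grouping the points by the integer part of their distance compares the sum with a
  geometric series of ratio \<open>exp (s' - s)\<close>.\<close>

lemma Poincare_bound:
  fixes x :: "'a::metric_space"
  assumes fin: "\<And>n. finite (Y \<inter> ball x (real n))"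
    and card: "\<And>n. real (card (Y \<inter> ball x (real n))) \<le> C * exp (s' * real n)"
    and "0 \<le> s'" "s' < s"
  shows "\<exists>P. \<forall>F. finite F \<longrightarrow> F \<subseteq> Y \<longrightarrow> (\<Sum>p\<in>F. exp (- s * dist x p)) \<le> P"
proof (intro exI allI impI)
  fix F assume F: "finite F" "F \<subseteq> Y"
  define r where "r = exp (s' - s)"
  have r: "0 < r" "r < 1" using assms by (auto simp: r_def)
  have C: "0 \<le> C" using card[of 0] by simp
  define f where "f p = nat \<lfloor>dist x p\<rfloor>" for p
  have f: "real (f p) \<le> dist x p" "dist x p < real (Suc (f p))" for p
    by (auto simp: f_def) linarith+
  have "(\<Sum>p\<in>F. exp (- s * dist x p)) = (\<Sum>n\<in>f ` F. \<Sum>p\<in>{p \<in> F. f p = n}. exp (- s * dist x p))"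
    using F(1) by (intro sum.group[symmetric]) auto
  also have "\<dots> \<le> (\<Sum>n\<in>f ` F. C * exp s' * r ^ n)"
  proof (rule sum_mono)
    fix n
    have "(\<Sum>p\<in>{p \<in> F. f p = n}. exp (- s * dist x p)) \<le> real (card {p \<in> F. f p = n}) * exp (- s * real n)"
      using f assms by (intro sum_bounded_above) (auto intro!: mult_left_mono)
    also have "\<dots> \<le> (C * exp (s' * real (Suc n))) * exp (- s * real n)"
    proof (rule mult_right_mono)
      have "card {p \<in> F. f p = n} \<le> card (Y \<inter> ball x (real (Suc n)))"
        using F f(2) by (intro card_mono fin) auto
      then show "real (card {p \<in> F. f p = n}) \<le> C * exp (s' * real (Suc n))"
        using card[of "Suc n"] by linarith
    qed simp
    also have "\<dots> = C * exp s' * r ^ n"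
    proof -
      have "exp (s' * real (Suc n)) * exp (- s * real n) = exp s' * r ^ n"
        by (simp add: r_def exp_of_nat_mult[symmetric] exp_add[symmetric] algebra_simps)
      then show ?thesis by (simp add: mult.assoc)
    qed
    finally show "(\<Sum>p\<in>{p \<in> F. f p = n}. exp (- s * dist x p)) \<le> C * exp s' * r ^ n" .
  qed
  also have "\<dots> \<le> C * exp s' * (\<Sum>n. r ^ n)"
    unfolding sum_distrib_left[symmetric] using r C F(1)
    by (intro mult_left_mono sum_le_suminf summable_geometric) auto
  finally show "(\<Sum>p\<in>F. exp (- s * dist x p)) \<le> C * exp s' * (\<Sum>n. exp (s' - s) ^ n)"
    by (simp add: r_def)
qed

text \<open>The notation \<open>inv\<close> for inverse functions clashes with the group inverse of HOL-Algebra.\<close>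

abbreviation ginv :: "('a \<Rightarrow> 'a) \<Rightarrow> 'a \<Rightarrow> 'a" where
  "ginv g \<equiv> inv_into UNIV g"

lemma isom_group_group: "group (isom_group :: ('a::metric_space \<Rightarrow> 'a) monoid)"
proof (rule groupI)
  fix g :: "'a \<Rightarrow> 'a" assume "g \<in> carrier isom_group"
  then have g: "bij g" "\<And>p q. dist (g p) (g q) = dist p q" by (auto simp: isom_group_def)
  have "dist (ginv g p) (ginv g q) = dist p q" for p q
    using g(2)[of "ginv g p" "ginv g q"] bij_is_surj[OF g(1)] by (simp add: surj_f_inv_f)
  then have "ginv g \<in> carrier isom_group" using bij_imp_bij_inv[OF g(1)] by (simp add: isom_group_def)
  moreover have "ginv g \<circ> g = id" using g(1) by (simp add: bij_is_inj)
  ultimately show "\<exists>h\<in>carrier isom_group. h \<otimes>\<^bsub>isom_group\<^esub> g = \<one>\<^bsub>isom_group\<^esub>"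
    by (auto simp: isom_group_def)
qed (auto simp: isom_group_def bij_comp fun_eq_iff)

locale discrete_action = gromov_hyperbolic x \<delta> for x :: "'a::metric_space" and \<delta> +
  fixes \<Gamma> :: "('a \<Rightarrow> 'a) set"
  assumes proper: "proper_space TYPE('a)"
    and subgroup: "subgroup \<Gamma> isom_group"
    and discrete: "discrete_isoms \<Gamma>"
begin

lemma bij_act: "g \<in> \<Gamma> \<Longrightarrow> bij g"
  and dist_act: "g \<in> \<Gamma> \<Longrightarrow> dist (g p) (g q) = dist p q"
  using subgroup.subset[OF subgroup] by (auto simp: isom_group_def)

lemma act_id: "id \<in> \<Gamma>"
  using subgroup.one_closed[OF subgroup] by (simp add: isom_group_def)

lemma act_comp: "g \<in> \<Gamma> \<Longrightarrow> h \<in> \<Gamma> \<Longrightarrow> g \<circ> h \<in> \<Gamma>"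
  using subgroup.m_closed[OF subgroup, of g h] by (simp add: isom_group_def)

lemma act_inv_f: "g \<in> \<Gamma> \<Longrightarrow> ginv g (g p) = p"
  and act_f_inv: "g \<in> \<Gamma> \<Longrightarrow> g (ginv g p) = p"
  using bij_act by (auto simp: bij_is_inj bij_is_surj inv_f_f surj_f_inv_f)

text \<open>Uniqueness of left inverses identifies the group inverse of HOL-Algebra with the inverse
  function.\<close>

lemma act_inv:
  assumes g: "g \<in> \<Gamma>"
  shows "ginv g \<in> \<Gamma>"
proof -
  interpret group "isom_group :: ('a \<Rightarrow> 'a) monoid" by (rule isom_group_group)
  have "g \<in> carrier isom_group" using subgroup.subset[OF subgroup] g by blast
  moreover have "ginv g \<in> carrier isom_group"
    using bij_imp_bij_inv[OF bij_act[OF g]] dist_act[OF g, of "ginv g _" "ginv g _"]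
    by (simp add: isom_group_def act_f_inv[OF g])
  moreover have "ginv g \<otimes>\<^bsub>isom_group\<^esub> g = \<one>\<^bsub>isom_group\<^esub>"
    using act_inv_f[OF g] by (simp add: isom_group_def fun_eq_iff)
  ultimately have "inv\<^bsub>isom_group\<^esub> g = ginv g" by (intro inv_equality)
  then show ?thesis using subgroup.m_inv_closed[OF subgroup g] by simp
qed

lemma gp_act: "g \<in> \<Gamma> \<Longrightarrow> gp (g w) (g p) (g q) = gp w p q"
  by (rule gp_isometry) (rule dist_act)

lemma dist_act_inv:
  assumes "g \<in> \<Gamma>"
  shows "dist (ginv g p) q = dist p (g q)" "dist p (ginv g q) = dist (g p) q"
  using dist_act[OF assms, of "ginv g p" q] dist_act[OF assms, of p "ginv g q"]
  by (simp_all add: act_f_inv[OF assms])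

lemma finite_displacement: "finite {g \<in> \<Gamma>. dist x (g x) \<le> R}"
proof (rule finite_subset)
  show "finite {g \<in> \<Gamma>. dist x (g x) \<le> max 0 R}"
    using discrete unfolding discrete_isoms_def by (meson max.cobounded1)
qed auto

lemma finite_orbit_ball: "finite (isom_orbit \<Gamma> x \<inter> ball x T)"
proof (rule finite_subset)
  show "isom_orbit \<Gamma> x \<inter> ball x T \<subseteq> (\<lambda>g. g x) ` {g \<in> \<Gamma>. dist x (g x) \<le> T}"
    by (auto simp: isom_orbit_def)
qed (intro finite_imageI finite_displacement)

lemma base_in_orbit: "x \<in> isom_orbit \<Gamma> x"
  unfolding isom_orbit_def using act_id by (metis id_apply imageI)

lemma card_orbit_ball_ge_1:
  assumes "0 < T"
  shows "1 \<le> card (isom_orbit \<Gamma> x \<inter> ball x T)"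
  using base_in_orbit assms finite_orbit_ball[of T] by (metis IntI card_0_eq centre_in_ball empty_iff not_one_le_zero linorder_not_less less_one)

section \<open>Orbit growth and vanishing of the packing measure\<close>

lemma critical_exponent_nonneg: "0 \<le> critical_exponent x \<Gamma>"
proof -
  have "\<forall>\<^sub>F T::real in at_top. 0 \<le> ereal (1 / T * ln (real (card (isom_orbit \<Gamma> x \<inter> ball x T))))"
    using eventually_gt_at_top[of 0]
  proof eventually_elim
    case (elim T)
    then show ?case using card_orbit_ball_ge_1[OF elim] by simp
  qed
  then have "0 \<le> Liminf at_top (\<lambda>T::real. ereal (1 / T * ln (real (card (isom_orbit \<Gamma> x \<inter> ball x T)))))"
    by (rule Liminf_bounded)
  also have "\<dots> \<le> critical_exponent x \<Gamma>"
    unfolding critical_exponent_def by (intro Liminf_le_Limsup) simp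
  finally show ?thesis .
qed

lemma orbit_growth_upper:
  assumes "critical_exponent x \<Gamma> < ereal s" "0 \<le> s"
  shows "\<exists>C. \<forall>n::nat. real (card (isom_orbit \<Gamma> x \<inter> ball x (real n))) \<le> C * exp (s * real n)"
proof -
  let ?c = "\<lambda>T. card (isom_orbit \<Gamma> x \<inter> ball x T)"
  have "\<forall>\<^sub>F T::real in at_top. ereal (1 / T * ln (real (?c T))) < ereal s"
    using assms(1) unfolding critical_exponent_def by (rule Limsup_lessD)
  then obtain T0 where T0: "\<And>T. T \<ge> T0 \<Longrightarrow> 1 / T * ln (real (?c T)) < s"
    unfolding eventually_at_top_linorder by auto
  define T1 where "T1 = max T0 1"
  have "real (?c (real n)) \<le> (1 + real (?c T1)) * exp (s * real n)" for n :: nat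
  proof (cases "real n \<ge> T1")
    case True
    then have n: "real n \<ge> T0" "0 < real n" by (auto simp: T1_def)
    then have "ln (real (?c (real n))) < s * real n" using T0[OF n(1)] by (simp add: field_simps)
    then have "real (?c (real n)) < exp (s * real n)"
      using card_orbit_ball_ge_1[OF n(2)] by (metis exp_less_mono exp_ln less_le_trans of_nat_1 of_nat_mono zero_less_one)
    also have "\<dots> \<le> (1 + real (?c T1)) * exp (s * real n)" by simp
    finally show ?thesis by simp
  next
    case False
    then have "?c (real n) \<le> ?c T1" by (intro card_mono finite_orbit_ball) auto
    also have "real \<dots> \<le> (1 + real (?c T1)) * 1" by simp
    also have "\<dots> \<le> (1 + real (?c T1)) * exp (s * real n)"
      using assms(2) by (intro mult_left_mono) auto
    finally show ?thesis by simp
  qed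
  then show ?thesis by blast
qed

theorem packing_measure_ergodic_zero:
  assumes "critical_exponent x \<Gamma> < ereal \<alpha>"
  shows "packing_measure x \<alpha> (ergodic_limit_set x \<Gamma>) = 0"
proof -
  \<comment> \<open>Exponents \<open>s' < s < \<beta> < \<alpha>\<close> are used: orbit growth is
    bounded at rate \<open>s'\<close>, Poincare sums are bounded at \<open>s\<close>, premeasures
    are finite at \<open>\<beta>\<close>, and the measure vanishes at
    \<open>\<alpha>\<close>.\<close>
  obtain s' where s': "critical_exponent x \<Gamma> < ereal s'" "s' < \<alpha>"
    using ereal_dense2[OF assms] by auto
  have s'0: "0 \<le> s'" using le_less_trans[OF critical_exponent_nonneg s'(1)] by simp
  obtain \<beta> where \<beta>: "s' < \<beta>" "\<beta> < \<alpha>" using dense[OF s'(2)] by blast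
  obtain s where s: "s' < s" "s < \<beta>" using dense[OF \<beta>(1)] by blast
  \<comment> \<open>Makes \<open>\<beta> * \<kappa>\<close> equal to \<open>s\<close>, the exponent
    of the Poincare sum that controls packings at \<open>\<beta>\<close>.\<close>
  define \<kappa> where "\<kappa> = s / \<beta>"
  have \<kappa>: "0 < \<kappa>" "\<kappa> < 1" "\<beta> * \<kappa> = s" using s s'0 by (auto simp: \<kappa>_def)
  obtain C where C: "\<And>n::nat. real (card (isom_orbit \<Gamma> x \<inter> ball x (real n))) \<le> C * exp (s' * real n)"
    using orbit_growth_upper[OF s'(1) s'0] by blast
  obtain P where P: "\<And>F. finite F \<Longrightarrow> F \<subseteq> isom_orbit \<Gamma> x \<Longrightarrow> (\<Sum>p\<in>F. exp (- s * dist x p)) \<le> P"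
    using Poincare_bound[OF finite_orbit_ball C s'0 s(1)] by blast
  let ?A = "\<lambda>n::nat. radial_set (isom_orbit \<Gamma> x) \<kappa> (real n)"
  show ?thesis
  proof (rule packing_measure_zeroI[of \<beta> \<alpha> _ ?A])
    show "0 \<le> \<beta>" "\<beta> < \<alpha>" using \<beta> s'0 by auto
    show "ergodic_limit_set x \<Gamma> \<subseteq> (\<Union>n. ?A n)"
      using ergodic_subset_radial[OF _ _ _ \<kappa>(1,2)] act_id by (fastforce simp: ergodic_limit_set_def)
    show "?A n \<subseteq> gromov_boundary x" for n by (auto simp: radial_set_def)
    show "packing_premeasure x \<beta> (?A n) < \<infinity>" for n
      using P \<beta> s'0 \<kappa> by (intro packing_premeasure_radial_set[where P = P]) auto
  qed
qed

end

section \<open>Groups fixing a boundary point\<close>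

context discrete_action
begin

text \<open>The hyperbolic inequality with base point \<open>s\<close>, rewritten in
  distances.\<close>

lemma four_point:
  "dist p q + dist r (s::'a) \<le> max (dist p r + dist q s) (dist p s + dist q r) + 2 * \<delta>"
  using hyp[of s p r q]
  by (simp add: gromov_product_def dist_commute min_def max_def field_simps split: if_splits)

text \<open>Says that \<open>a\<close> tends to a boundary point fixed by all of \<Gamma>, without
  setting up the action on the boundary; \<open>a\<close> and its image are compared along the
  diagonal.\<close>

definition fixed_direction :: "(nat \<Rightarrow> 'a) \<Rightarrow> bool" where
  "fixed_direction a \<longleftrightarrow> gp_to_infinity x a a \<and>
     (\<forall>g\<in>\<Gamma>. \<forall>K. \<forall>\<^sub>F k in sequentially. K \<le> gp x (a k) (g (a k)))"

lemma fixed_directionD: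
  "fixed_direction a \<Longrightarrow> g \<in> \<Gamma> \<Longrightarrow> \<forall>\<^sub>F k in sequentially. K \<le> gp x (a k) (g (a k))"
  by (auto simp: fixed_direction_def)

text \<open>Products with \<open>y\<close> never exceed \<open>dist x y\<close>, so the minimum in
  the hyperbolic inequality, applied in both directions, is always the product with
  \<open>y\<close>.\<close>

lemma gp_stable:
  assumes "dist x y \<le> gp x p q"
  shows "\<bar>gp x y p - gp x y (q::'a)\<bar> \<le> \<delta>"
proof -
  have "gp x y p \<le> gp x p q" "gp x y q \<le> gp x q p"
    using assms gp_le_dist(1)[of x y p] gp_le_dist(1)[of x y q] by (simp_all add: gp_commute[of x q])
  then have "gp x y p - \<delta> \<le> gp x y q" "gp x y q - \<delta> \<le> gp x y p"
    by (auto intro: hyp_ge)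
  then show ?thesis by linarith
qed

text \<open>\<open>b\<close> is a coarse Busemann function normalised at \<open>x\<close>: by
  \<open>gp_stable\<close> the differences of distances eventually stay in a window of bounded
  width, whether or not they converge.\<close>

lemma busemann_exists:
  assumes "gp_to_infinity x a a"
  shows "\<exists>b. \<forall>y. \<forall>\<^sub>F k in sequentially. \<bar>dist y (a k) - dist x (a k) - b y\<bar> \<le> 2 * \<delta>"
proof -
  have "\<exists>c. \<forall>\<^sub>F k in sequentially. \<bar>dist y (a k) - dist x (a k) - c\<bar> \<le> 2 * \<delta>" for y
  proof -
    obtain N where N: "\<And>n m. n \<ge> N \<Longrightarrow> m \<ge> N \<Longrightarrow> dist x y \<le> gp x (a n) (a m)"
      using assms unfolding gp_to_infinity_def by meson
    have "\<bar>dist y (a k) - dist x (a k) - (dist x y - 2 * gp x y (a N))\<bar> \<le> 2 * \<delta>" if "k \<ge> N" for k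
      using gp_stable[OF N[OF that order_refl]] dist_eq_gp[of y "a k" x] by linarith
    then show ?thesis by (auto simp: eventually_sequentially)
  qed
  then show ?thesis by metis
qed

text \<open>The element moves to the other side as its inverse applied to \<open>a k\<close>, which
  keeps the direction. Three Busemann errors 2\<delta> and twice the error \<delta> of
  \<open>gp_stable\<close> add up to 8\<delta>.\<close>

lemma busemann_quasi_invariant:
  assumes a: "fixed_direction a" and g: "g \<in> \<Gamma>"
    and b: "\<And>y. \<forall>\<^sub>F k in sequentially. \<bar>dist y (a k) - dist x (a k) - b y\<bar> \<le> 2 * \<delta>"
  shows "\<bar>b (g y) - b (g x) - b y\<bar> \<le> 8 * \<delta>"
proof -
  have "\<forall>\<^sub>F k in sequentially. \<bar>b (g y) - b (g x) - b y\<bar> \<le> 8 * \<delta>"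
    using b[of "g y"] b[of "g x"] b[of y] fixed_directionD[OF a act_inv[OF g], of "dist x y"]
  proof eventually_elim
    case (elim k)
    have "dist (g y) (a k) = dist y (ginv g (a k))" "dist (g x) (a k) = dist x (ginv g (a k))"
      using dist_act_inv[OF g] by (simp_all add: dist_commute)
    then show ?case
      using elim(1-3) gp_stable[OF elim(4)] dist_eq_gp[of y "a k" x] dist_eq_gp[of y "ginv g (a k)" x]
      by linarith
  qed
  then show ?thesis by simp
qed

text \<open>The element \<open>h\<^sup>-\<^sup>1\<close> pushes \<open>x\<close> deep towards the fixed direction, where \<open>g\<close> acts almost as a
  translation by its Busemann shift.\<close>

lemma conjugate_displacement:
  assumes a: "fixed_direction a" and g: "g \<in> \<Gamma>" and h: "h \<in> \<Gamma>"
    and b: "\<And>y. \<forall>\<^sub>F k in sequentially. \<bar>dist y (a k) - dist x (a k) - b y\<bar> \<le> 2 * \<delta>"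
    and K: "\<forall>\<^sub>F k in sequentially. gp x (h x) (a k) \<le> K"
    and far: "dist x (g x) + K + 3 * \<delta> < dist x (h x)"
  shows "dist x ((h \<circ> g \<circ> ginv h) x) \<le> \<bar>b (g x)\<bar> + 2 * K + 20 * \<delta>"
proof -
  define y where "y = ginv h x"
  have hy: "h y = x" by (simp add: y_def act_f_inv[OF h])
  have dxy: "dist x y = dist x (h x)"
    using dist_act[OF h, of x y] by (simp add: hy dist_commute)
  have eq: "dist x ((h \<circ> g \<circ> ginv h) x) = dist y (g y)"
    using dist_act[OF h, of y "g y"] hy by (simp add: y_def)
  have "\<forall>\<^sub>F k in sequentially. dist y (g y) \<le> \<bar>b (g x)\<bar> + 2 * K + 20 * \<delta>"
    using b[of y] b[of "g y"] K fixed_directionD[OF a h, of "K + \<delta> + 1"]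
      fixed_directionD[OF a act_inv[OF g], of "K + 3 * \<delta> + 1 + dist x y"]
  proof eventually_elim
    case (elim k)
    note d = delta_nonneg
    \<comment> \<open>As \<open>h\<close> keeps the direction, the bound \<open>K\<close> passes
      from \<open>a k\<close> to \<open>h (a k)\<close>. Applying the inverse of \<open>h\<close>
      shows that \<open>y\<close> is close to the way from \<open>x\<close> to
      \<open>a k\<close>.\<close>
    have 1: "gp y x (a k) \<le> K + \<delta>"
    proof -
      have "gp x (h x) (h (a k)) \<le> K + \<delta>"
        using hyp[of x "h x" "h (a k)" "a k"] elim(3,4) d by (auto simp: gp_commute[of x "a k"] min_def split: if_splits)
      then show ?thesis using gp_act[OF h, of y x "a k"] hy by simp
    qed
    \<comment> \<open>Seen from the distant point \<open>y\<close>, the points \<open>x\<close> and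
      \<open>ginv g x\<close> lie in nearly the same direction.\<close>
    have 2: "gp y (ginv g x) (a k) \<le> K + 2 * \<delta>"
    proof -
      have "dist x (ginv g x) = dist x (g x)" using dist_act_inv(2)[OF g] by (simp add: dist_commute)
      then have "K + 2 * \<delta> < gp y x (ginv g x)"
        using gp_add_gp[of x y "ginv g x"] gp_le_dist(2)[of x y "ginv g x"] far dxy d by simp
      then show ?thesis using hyp[of y x "ginv g x" "a k"] 1 d by (auto simp: min_def split: if_splits)
    qed
    \<comment> \<open>So do \<open>a k\<close> and \<open>ginv g (a k)\<close>; applying
      \<open>g\<close> then puts \<open>g y\<close> close to the way from \<open>x\<close> to
      \<open>a k\<close> as well.\<close>
    have 3: "gp (g y) x (a k) \<le> K + 3 * \<delta>"
    proof -
      have "K + 3 * \<delta> + 1 \<le> gp y (ginv g (a k)) (a k)"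
        using elim(5) gp_change_base[of x "a k" "ginv g (a k)" y] by (simp add: gp_commute)
      then have "gp y (ginv g x) (ginv g (a k)) \<le> K + 3 * \<delta>"
        using hyp[of y "ginv g x" "ginv g (a k)" "a k"] 2 d by (auto simp: min_def split: if_splits)
      then show ?thesis
        using gp_act[OF g, of y "ginv g x" "ginv g (a k)"] by (simp add: act_f_inv[OF g])
    qed
    have c1: "dist x y \<le> 2 * K + 2 * \<delta> + dist x (a k) - dist y (a k)"
      using 1 by (simp add: gromov_product_def dist_commute)
    have c2: "dist x (g y) \<le> 2 * K + 6 * \<delta> + dist x (a k) - dist (g y) (a k)"
      using 3 by (simp add: gromov_product_def dist_commute)
    \<comment> \<open>In either case the distance is bounded by a difference of Busemann values of
      \<open>y\<close> and \<open>g y\<close>, which is \<open>b (g x)\<close> up to sign and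
      8\<delta>.\<close>
    have "dist y (g y) + dist x (a k) \<le> dist x y + dist (g y) (a k) + 2 * \<delta>
        \<or> dist y (g y) + dist x (a k) \<le> dist y (a k) + dist x (g y) + 2 * \<delta>"
      using four_point[of y "g y" x "a k"] by (simp add: dist_commute max_def split: if_splits)
    then show ?case
      using c1 c2 elim(1,2) busemann_quasi_invariant[OF a g b, of y] d by linarith
  qed
  then show ?thesis using eq by simp
qed

text \<open>Conjugation by a suitable far \<open>h\<close> embeds each finite part of
  \<open>E\<close> into the finite set \<open>D\<close>, so \<open>E\<close> is finite. Every strip
  of Busemann values is carried into \<open>E\<close> by a left translation, and elements of
  displacement at most \<open>n\<close> meet only linearly many strips.\<close>

lemma fixed_direction_linear_growth:
  assumes a: "fixed_direction a"
    and far: "\<And>R. \<exists>h\<in>\<Gamma>. R \<le> dist x (h x) \<and> (\<forall>\<^sub>F k in sequentially. gp x (h x) (a k) \<le> K)"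
  shows "\<exists>C. \<forall>n::nat. real (card {g \<in> \<Gamma>. dist x (g x) \<le> real n}) \<le> C * (real n + 1)"
proof -
  obtain b where b: "\<And>y. \<forall>\<^sub>F k in sequentially. \<bar>dist y (a k) - dist x (a k) - b y\<bar> \<le> 2 * \<delta>"
    using busemann_exists a unfolding fixed_direction_def by blast
  \<comment> \<open>Busemann values in a common strip differ by at most 2, and quasi-invariance adds
    8\<delta>.\<close>
  define r where "r = 2 + 8 * \<delta>"
  define E where "E = {g \<in> \<Gamma>. \<bar>b (g x)\<bar> \<le> r}"
  define D where "D = {g \<in> \<Gamma>. dist x (g x) \<le> r + 2 * K + 20 * \<delta>}"
  have finD: "finite D" unfolding D_def by (rule finite_displacement)
  have "card F \<le> card D" if F: "finite F" "F \<subseteq> E" for F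
  proof -
    \<comment> \<open>A bound for all of the finite set \<open>F\<close>, so that a single
      \<open>h\<close> serves every element.\<close>
    obtain R where R: "\<And>g. g \<in> F \<Longrightarrow> dist x (g x) < R"
    proof
      show "dist x (g x) < (\<Sum>f\<in>F. dist x (f x)) + 1" if "g \<in> F" for g
        using member_le_sum[OF that, of "\<lambda>f. dist x (f x)"] F(1) by force
    qed
    obtain h where h: "h \<in> \<Gamma>" "R + K + 3 * \<delta> \<le> dist x (h x)"
      "\<forall>\<^sub>F k in sequentially. gp x (h x) (a k) \<le> K"
      using far by blast
    let ?f = "\<lambda>g. h \<circ> g \<circ> ginv h"
    have "inj_on ?f F"
    proof (rule inj_onI)
      fix g g' assume "?f g = ?f g'"
      then have "\<And>p. h (g (ginv h (h p))) = h (g' (ginv h (h p)))" by (metis comp_apply)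
      then show "g = g'" using act_inv_f[OF h(1)] by (metis ext)
    qed
    moreover have "?f ` F \<subseteq> D"
    proof
      fix f assume "f \<in> ?f ` F"
      then obtain g where g: "g \<in> F" "f = ?f g" by blast
      then have gE: "g \<in> \<Gamma>" "\<bar>b (g x)\<bar> \<le> r" using F(2) by (auto simp: E_def)
      have "dist x (?f g x) \<le> \<bar>b (g x)\<bar> + 2 * K + 20 * \<delta>"
        using R[OF g(1)] h(2) by (intro conjugate_displacement[OF a gE(1) h(1) b h(3)]) simp
      then show "f \<in> D" using gE g(2) act_comp[OF act_comp[OF h(1) gE(1)] act_inv[OF h(1)]] by (simp add: D_def)
    qed
    ultimately show ?thesis using finD by (intro card_inj_on_le)
  qed
  then have finE: "finite E" using finite_if_finite_subsets_card_bdd[of E "card D"] by blast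
  have strip: "card {g \<in> \<Gamma>. \<bar>b (g x) - s\<bar> \<le> 1} \<le> card E \<and> finite {g \<in> \<Gamma>. \<bar>b (g x) - s\<bar> \<le> 1}" for s
  proof (cases "{g \<in> \<Gamma>. \<bar>b (g x) - s\<bar> \<le> 1} = {}")
    case False
    then obtain g0 where g0: "g0 \<in> \<Gamma>" "\<bar>b (g0 x) - s\<bar> \<le> 1" by blast
    let ?S = "{g \<in> \<Gamma>. \<bar>b (g x) - s\<bar> \<le> 1}" and ?f = "\<lambda>g. ginv g0 \<circ> g"
    have inj: "inj_on ?f ?S"
    proof (rule inj_onI)
      fix g g' assume "?f g = ?f g'"
      then have "\<And>p. g0 (ginv g0 (g p)) = g0 (ginv g0 (g' p))" by (metis comp_apply)
      then show "g = g'" using act_f_inv[OF g0(1)] by (metis ext)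
    qed
    have sub: "?f ` ?S \<subseteq> E"
    proof
      fix f assume "f \<in> ?f ` ?S"
      then obtain g where g: "g \<in> \<Gamma>" "\<bar>b (g x) - s\<bar> \<le> 1" "f = ?f g" by blast
      have "\<bar>b (g0 (f x)) - b (g0 x) - b (f x)\<bar> \<le> 8 * \<delta>"
        by (rule busemann_quasi_invariant[OF a g0(1) b])
      then have "\<bar>b (f x)\<bar> \<le> r" using g g0 by (simp add: act_f_inv[OF g0(1)] r_def)
      then show "f \<in> E" using g act_comp[OF act_inv[OF g0(1)] g(1)] by (simp add: E_def)
    qed
    show ?thesis using inj sub finE by (meson card_inj_on_le inj_on_finite)
  next
    case True
    then show ?thesis by (simp only: card.empty finite.emptyI zero_le simp_thms)
  qed
  define M where "M = nat \<lceil>2 * \<delta>\<rceil> + 1"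
  have "real (card {g \<in> \<Gamma>. dist x (g x) \<le> real n}) \<le> (real (2 * M + 1) * card E) * (real n + 1)" for n :: nat
  proof -
    let ?J = "{- int (n + M)..int (n + M)}"
    have "{g \<in> \<Gamma>. dist x (g x) \<le> real n} \<subseteq> (\<Union>j\<in>?J. {g \<in> \<Gamma>. \<bar>b (g x) - real_of_int j\<bar> \<le> 1})"
    proof
      fix g assume g: "g \<in> {g \<in> \<Gamma>. dist x (g x) \<le> real n}"
      have "\<forall>\<^sub>F k in sequentially. \<bar>b (g x)\<bar> \<le> dist x (g x) + 2 * \<delta>"
        using b[of "g x"]
      proof eventually_elim
        case (elim k)
        then show ?case using dist_triangle[of "g x" "a k" x] dist_triangle[of x "a k" "g x"]
          by (simp add: dist_commute)
      qed
      then have "\<bar>b (g x)\<bar> \<le> dist x (g x) + 2 * \<delta>" by simp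
      moreover have "2 * \<delta> + 1 \<le> real M" using delta_nonneg by (simp add: M_def)
      ultimately have "\<lfloor>b (g x)\<rfloor> \<in> ?J" using g by auto linarith+
      moreover have "\<bar>b (g x) - real_of_int \<lfloor>b (g x)\<rfloor>\<bar> \<le> 1" by linarith
      ultimately show "g \<in> (\<Union>j\<in>?J. {g \<in> \<Gamma>. \<bar>b (g x) - real_of_int j\<bar> \<le> 1})"
        using g by blast
    qed
    then have "card {g \<in> \<Gamma>. dist x (g x) \<le> real n} \<le> card (\<Union>j\<in>?J. {g \<in> \<Gamma>. \<bar>b (g x) - real_of_int j\<bar> \<le> 1})"
      using strip by (intro card_mono finite_UN_I) auto
    also have "\<dots> \<le> (\<Sum>j\<in>?J. card {g \<in> \<Gamma>. \<bar>b (g x) - real_of_int j\<bar> \<le> 1})"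
      by (rule card_UN_le) simp
    also have "\<dots> \<le> (\<Sum>j\<in>?J. card E)" using strip by (intro sum_mono) blast
    also have "\<dots> = (2 * (n + M) + 1) * card E"
    proof -
      have "card ?J = 2 * (n + M) + 1" by (simp add: nat_eq_iff)
      then show ?thesis by simp
    qed
    also have "\<dots> \<le> ((2 * M + 1) * (n + 1)) * card E"
    proof (rule mult_right_mono)
      have "n \<le> M * n" by (simp add: M_def)
      then show "2 * (n + M) + 1 \<le> (2 * M + 1) * (n + 1)" by (simp add: algebra_simps)
    qed simp
    finally have "real (card {g \<in> \<Gamma>. dist x (g x) \<le> real n}) \<le> real ((2 * M + 1) * (n + 1) * card E)"
      by (rule of_nat_mono)
    then show ?thesis by (simp add: algebra_simps)
  qed
  then show ?thesis by blast
qed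

text \<open>Otherwise all distant orbit points have large product with \<open>a\<close>; then any
  two orbit sequences tending to the boundary are equivalent, and the limit set has at most one
  point.\<close>

lemma limit_set_far:
  assumes a: "gp_to_infinity x a a" and "non_elementary x \<Gamma>"
  shows "\<exists>K. \<forall>R. \<exists>h\<in>\<Gamma>. R \<le> dist x (h x) \<and> (\<forall>\<^sub>F k in sequentially. gp x (h x) (a k) \<le> K)"
proof (rule ccontr)
  assume "\<not> ?thesis"
  then have "\<exists>R. \<forall>h\<in>\<Gamma>. R \<le> dist x (h x) \<longrightarrow> \<not> (\<forall>\<^sub>F k in sequentially. gp x (h x) (a k) \<le> K)" for K
    by blast
  then obtain R where R: "\<And>K h. h \<in> \<Gamma> \<Longrightarrow> R K \<le> dist x (h x) \<Longrightarrow> \<not> (\<forall>\<^sub>F k in sequentially. gp x (h x) (a k) \<le> K)"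
    by metis
  \<comment> \<open>The negated statement gives a large product for arbitrarily late
    \<open>k\<close> only; \<open>gp_stable\<close> upgrades this to all late \<open>k\<close> at
    the cost of \<delta>.\<close>
  have ev: "\<forall>\<^sub>F k in sequentially. C \<le> gp x (h x) (a k)" if h: "h \<in> \<Gamma>" "R (C + \<delta>) \<le> dist x (h x)" for C h
  proof -
    obtain N where N: "\<And>n m. n \<ge> N \<Longrightarrow> m \<ge> N \<Longrightarrow> dist x (h x) \<le> gp x (a n) (a m)"
      using a unfolding gp_to_infinity_def by meson
    obtain m where m: "m \<ge> N" "C + \<delta> < gp x (h x) (a m)"
      using R[OF h] by (auto simp: eventually_sequentially not_le)
    have "C \<le> gp x (h x) (a k)" if "k \<ge> N" for k
      using gp_stable[OF N[OF that m(1)]] m(2) by linarith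
    then show ?thesis by (auto simp: eventually_sequentially)
  qed
  have unique: "z = z'" if z: "z \<in> limit_set x \<Gamma>" "z' \<in> limit_set x \<Gamma>" for z z'
  proof -
    obtain u v where u: "z \<in> gromov_boundary x" "range u \<subseteq> isom_orbit \<Gamma> x" "u \<in> z"
      and v: "z' \<in> gromov_boundary x" "range v \<subseteq> isom_orbit \<Gamma> x" "v \<in> z'"
      using z by (auto simp: limit_set_def)
    show ?thesis
    proof (rule boundary_eqI[OF u(1) v(1) u(3) v(3)], unfold gp_to_infinity_def, rule allI)
      fix C
      obtain N where N: "\<And>n. n \<ge> N \<Longrightarrow> R (C + \<delta> + \<delta>) \<le> dist x (u n)"
        using gromov_seqs_dist[OF boundary_seqs[OF u(1,3)]] by meson
      obtain M where M: "\<And>n. n \<ge> M \<Longrightarrow> R (C + \<delta> + \<delta>) \<le> dist x (v n)"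
        using gromov_seqs_dist[OF boundary_seqs[OF v(1,3)]] by meson
      have "C \<le> gp x (u n) (v m)" if "n \<ge> max N M" "m \<ge> max N M" for n m
      proof -
        obtain g h where g: "g \<in> \<Gamma>" "u n = g x" and h: "h \<in> \<Gamma>" "v m = h x"
          using range_subsetD[OF u(2), of n] range_subsetD[OF v(2), of m] by (auto simp: isom_orbit_def)
        have "\<forall>\<^sub>F k in sequentially. C + \<delta> \<le> gp x (g x) (a k)"
          using N[of n] that g by (intro ev) auto
        moreover have "\<forall>\<^sub>F k in sequentially. C + \<delta> \<le> gp x (h x) (a k)"
          using M[of m] that h by (intro ev) auto
        ultimately have "\<forall>\<^sub>F k in sequentially. C \<le> gp x (g x) (h x)"
        proof eventually_elim
          case (elim k)
          then show ?case using hyp_ge[of "C + \<delta>" x "g x" "a k" "h x"] by (simp add: gp_commute)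
        qed
        then show ?thesis by (simp add: g h)
      qed
      then show "\<exists>N. \<forall>n\<ge>N. \<forall>m\<ge>N. C \<le> gp x (u n) (v m)" by blast
    qed
  qed
  have "card (limit_set x \<Gamma>) \<le> 1 \<and> finite (limit_set x \<Gamma>)"
  proof (cases "limit_set x \<Gamma> = {}")
    case False
    then obtain z where "limit_set x \<Gamma> = {z}" using unique by blast
    then show ?thesis by simp
  qed simp
  then show False using assms(2) by (auto simp: non_elementary_def)
qed

end

section \<open>Schottky sets with many elements\<close>

context discrete_action
begin

section \<open>Light sets of group elements\<close>

definition annulus :: "('a \<Rightarrow> 'a) set \<Rightarrow> nat \<Rightarrow> ('a \<Rightarrow> 'a) set" where
  "annulus A n = {g \<in> A. real n \<le> dist x (g x) \<and> dist x (g x) < real n + 1}"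

definition light :: "real \<Rightarrow> ('a \<Rightarrow> 'a) set \<Rightarrow> bool" where
  "light \<alpha> A \<longleftrightarrow> (\<exists>C. \<forall>n. real (card (annulus A n)) \<le> C * exp (\<alpha> * real n))"

lemma finite_annulus: "A \<subseteq> \<Gamma> \<Longrightarrow> finite (annulus A n)"
  by (rule finite_subset[OF _ finite_displacement[of "real n + 1"]]) (auto simp: annulus_def)

lemma light_mono:
  assumes "light \<alpha> B" "A \<subseteq> B" "B \<subseteq> \<Gamma>"
  shows "light \<alpha> A"
proof -
  obtain C where C: "\<And>n. real (card (annulus B n)) \<le> C * exp (\<alpha> * real n)"
    using assms(1) by (auto simp: light_def)
  have "real (card (annulus A n)) \<le> C * exp (\<alpha> * real n)" for n
  proof -
    have "card (annulus A n) \<le> card (annulus B n)"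
      using assms(2,3) by (intro card_mono finite_annulus) (auto simp: annulus_def)
    then show ?thesis using C[of n] by linarith
  qed
  then show ?thesis unfolding light_def by blast
qed

lemma light_Un:
  assumes "light \<alpha> A" "light \<alpha> B"
  shows "light \<alpha> (A \<union> B)"
proof -
  obtain C D where C: "\<And>n. real (card (annulus A n)) \<le> C * exp (\<alpha> * real n)"
    and D: "\<And>n. real (card (annulus B n)) \<le> D * exp (\<alpha> * real n)"
    using assms by (auto simp: light_def)
  have "real (card (annulus (A \<union> B) n)) \<le> (C + D) * exp (\<alpha> * real n)" for n
  proof -
    have "annulus (A \<union> B) n = annulus A n \<union> annulus B n" by (auto simp: annulus_def)
    then have "card (annulus (A \<union> B) n) \<le> card (annulus A n) + card (annulus B n)"
      by (metis card_Un_le)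
    then show ?thesis using C[of n] D[of n] by (simp add: distrib_right)
  qed
  then show ?thesis unfolding light_def by blast
qed

lemma light_finite:
  assumes "finite A" "0 \<le> \<alpha>"
  shows "light \<alpha> A"
proof -
  have "real (card (annulus A n)) \<le> real (card A) * exp (\<alpha> * real n)" for n
  proof -
    have "card (annulus A n) \<le> card A" using assms(1) by (intro card_mono) (auto simp: annulus_def)
    then have "real (card (annulus A n)) \<le> real (card A) * 1" by simp
    also have "\<dots> \<le> real (card A) * exp (\<alpha> * real n)" using assms(2) by (intro mult_left_mono) auto
    finally show ?thesis .
  qed
  then show ?thesis unfolding light_def by blast
qed

lemma light_UN:
  assumes "finite I" "0 \<le> \<alpha>" "\<And>i. i \<in> I \<Longrightarrow> light \<alpha> (A i)"
  shows "light \<alpha> (\<Union>i\<in>I. A i)"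
  using assms(1,3)
proof (induction I rule: finite_induct)
  case empty
  show ?case using light_finite[OF finite.emptyI assms(2)] by simp
next
  case (insert i I)
  have "light \<alpha> (A i \<union> (\<Union>i\<in>I. A i))" using insert by (intro light_Un) auto
  then show ?case by simp
qed

text \<open>Summing the annuli would bound the orbit points in the ball of radius \<open>T\<close>
  by \<open>C * (T + 1) * exp (\<alpha> * T)\<close>, whose exponential rate is \<alpha>.\<close>

lemma not_light_all:
  assumes "ereal \<alpha> < critical_exponent x \<Gamma>" "0 \<le> \<alpha>"
  shows "\<not> light \<alpha> \<Gamma>"
proof
  assume "light \<alpha> \<Gamma>"
  then obtain C0 where C0: "\<And>n. real (card (annulus \<Gamma> n)) \<le> C0 * exp (\<alpha> * real n)"
    by (auto simp: light_def)
  define C where "C = max C0 1"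
  have C: "real (card (annulus \<Gamma> n)) \<le> C * exp (\<alpha> * real n)" for n
    by (rule order_trans[OF C0]) (simp add: C_def mult_right_mono)
  have C1: "1 \<le> C" by (simp add: C_def)
  have bound: "1 / T * ln (real (card (isom_orbit \<Gamma> x \<inter> ball x T))) \<le> \<alpha> + ln (C * (T + 1)) / T"
    if T: "T \<ge> 1" for T
  proof -
    let ?N = "nat \<lceil>T\<rceil>"
    have "isom_orbit \<Gamma> x \<inter> ball x T \<subseteq> (\<Union>n<?N. (\<lambda>g. g x) ` annulus \<Gamma> n)"
    proof
      fix p assume "p \<in> isom_orbit \<Gamma> x \<inter> ball x T"
      then obtain g where g: "g \<in> \<Gamma>" "p = g x" "dist x (g x) < T" by (auto simp: isom_orbit_def)
      define n where "n = nat \<lfloor>dist x (g x)\<rfloor>"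
      have n: "real n \<le> dist x (g x)" "dist x (g x) < real n + 1" by (auto simp: n_def)
      have "n < ?N" using n(1) g(3) by linarith
      then show "p \<in> (\<Union>n<?N. (\<lambda>g. g x) ` annulus \<Gamma> n)" using g n by (auto simp: annulus_def)
    qed
    then have "card (isom_orbit \<Gamma> x \<inter> ball x T) \<le> card (\<Union>n<?N. (\<lambda>g. g x) ` annulus \<Gamma> n)"
      by (intro card_mono) (auto intro: finite_annulus)
    also have "\<dots> \<le> (\<Sum>n<?N. card ((\<lambda>g. g x) ` annulus \<Gamma> n))" by (rule card_UN_le) simp
    also have "\<dots> \<le> (\<Sum>n<?N. card (annulus \<Gamma> n))"
      by (intro sum_mono card_image_le finite_annulus) simp
    finally have "real (card (isom_orbit \<Gamma> x \<inter> ball x T)) \<le> (\<Sum>n<?N. real (card (annulus \<Gamma> n)))"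
      by (metis of_nat_mono of_nat_sum)
    also have "\<dots> \<le> (\<Sum>n<?N. C * exp (\<alpha> * T))"
    proof (rule sum_mono)
      fix n assume "n \<in> {..<?N}"
      then have "real n \<le> T" by simp linarith
      then have "exp (\<alpha> * real n) \<le> exp (\<alpha> * T)" using assms(2) by (simp add: mult_left_mono)
      then show "real (card (annulus \<Gamma> n)) \<le> C * exp (\<alpha> * T)"
        using C[of n] mult_left_mono[of "exp (\<alpha> * real n)" "exp (\<alpha> * T)" C] C1 by linarith
    qed
    also have "\<dots> = real ?N * (C * exp (\<alpha> * T))" by simp
    also have "\<dots> \<le> (T + 1) * (C * exp (\<alpha> * T))"
    proof (rule mult_right_mono)
      show "real ?N \<le> T + 1" using T by linarith
    qed (use C1 in simp)
    finally have le: "real (card (isom_orbit \<Gamma> x \<inter> ball x T)) \<le> C * (T + 1) * exp (\<alpha> * T)"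
      by (simp add: mult_ac)
    have "ln (real (card (isom_orbit \<Gamma> x \<inter> ball x T))) \<le> ln (C * (T + 1) * exp (\<alpha> * T))"
      using card_orbit_ball_ge_1[of T] T le by (subst ln_le_cancel_iff) auto
    also have "\<dots> = ln (C * (T + 1)) + \<alpha> * T" using C1 T by (simp add: ln_mult)
    finally have "1 / T * ln (real (card (isom_orbit \<Gamma> x \<inter> ball x T))) \<le> 1 / T * (ln (C * (T + 1)) + \<alpha> * T)"
      using T by (intro mult_left_mono) auto
    then show ?thesis using T by (simp add: field_simps)
  qed
  have "((\<lambda>T. \<alpha> + ln (C * (T + 1)) / T) \<longlongrightarrow> \<alpha>) at_top"
    using C1 by real_asymp
  then have lim: "((\<lambda>T. ereal (\<alpha> + ln (C * (T + 1)) / T)) \<longlongrightarrow> ereal \<alpha>) at_top"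
    by (rule tendsto_ereal)
  have "critical_exponent x \<Gamma> \<le> Limsup at_top (\<lambda>T. ereal (\<alpha> + ln (C * (T + 1)) / T))"
    unfolding critical_exponent_def
    by (intro Limsup_mono eventually_mono[OF eventually_ge_at_top[of 1]]) (use bound in auto)
  also have "\<dots> = ereal \<alpha>" using lim by (intro lim_imp_Limsup) auto
  finally show False using assms(1) by simp
qed

lemma linear_growth_light:
  assumes "0 < \<alpha>" "\<And>n::nat. real (card {g \<in> \<Gamma>. dist x (g x) \<le> real n}) \<le> C * (real n + 1)"
  shows "light \<alpha> \<Gamma>"
proof -
  have C: "0 \<le> C" using assms(2)[of 0] by simp
  have "real (card (annulus \<Gamma> n)) \<le> (C * (2 + 1 / \<alpha>)) * exp (\<alpha> * real n)" for n
  proof -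
    have "card (annulus \<Gamma> n) \<le> card {g \<in> \<Gamma>. dist x (g x) \<le> real (Suc n)}"
      by (intro card_mono finite_displacement) (auto simp: annulus_def)
    then have "real (card (annulus \<Gamma> n)) \<le> C * (real (Suc n) + 1)" using assms(2)[of "Suc n"] by linarith
    also have "\<dots> \<le> C * ((2 + 1 / \<alpha>) * (1 + \<alpha> * real n))"
      using assms(1) C by (intro mult_left_mono) (auto simp: field_simps)
    also have "\<dots> \<le> C * ((2 + 1 / \<alpha>) * exp (\<alpha> * real n))"
      using assms(1) C exp_ge_add_one_self[of "\<alpha> * real n"] by (intro mult_left_mono) auto
    finally show ?thesis by (simp add: mult.assoc)
  qed
  then show ?thesis unfolding light_def by blast
qed

section \<open>Non-light sets in transverse position\<close>

lemma geodesic_point: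
  assumes "0 \<le> t" "t \<le> dist x y"
  shows "\<exists>q. dist x q = t \<and> gp x y q = t"
proof -
  obtain \<gamma> :: "real \<Rightarrow> 'a" where \<gamma>: "\<gamma> 0 = x" "\<gamma> (dist x y) = y"
    "\<And>s t. s \<in> {0..dist x y} \<Longrightarrow> t \<in> {0..dist x y} \<Longrightarrow> dist (\<gamma> s) (\<gamma> t) = \<bar>s - t\<bar>"
    using geodesic unfolding geodesic_space_def by metis
  have "dist x (\<gamma> t) = t" "dist y (\<gamma> t) = dist x y - t"
    using \<gamma>(3)[of 0 t] \<gamma>(3)[of "dist x y" t] assms by (auto simp: \<gamma>(1,2))
  then show ?thesis by (intro exI[of _ "\<gamma> t"]) (simp add: gromov_product_def)
qed

text \<open>A far point is tagged by a net point near its geodesic from \<open>x\<close> at distance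
  \<open>R'\<close>. Tagging both \<open>g x\<close> and \<open>ginv g x\<close> cuts
  \<open>A\<close>, apart from finitely many elements, into finitely many pieces, and one of them is
  not light.\<close>

lemma refine_not_light:
  assumes A: "A \<subseteq> \<Gamma>" "\<not> light \<alpha> A" and "0 \<le> \<alpha>"
  shows "\<exists>B\<subseteq>A. \<not> light \<alpha> B \<and>
    (\<forall>g\<in>B. \<forall>g'\<in>B. R \<le> gp x (g x) (g' x) \<and> R \<le> gp x (ginv g x) (ginv g' x))"
proof -
  \<comment> \<open>The 1 pays for the mesh of the net, and \<delta> for comparing two points with
    the same tag.\<close>
  define R' where "R' = max 0 R + \<delta> + 1"
  have R': "0 \<le> R'" "R + \<delta> + 1 \<le> R'" using delta_nonneg by (auto simp: R'_def)
  have "compact (cball x R')" using proper by (simp add: proper_space_def)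
  then obtain P where P: "finite P" "cball x R' \<subseteq> (\<Union>p\<in>P. ball p 1)"
    using compact_imp_seq_compact seq_compact_imp_totally_bounded by (metis zero_less_one)
  have net: "\<exists>p\<in>P. R + \<delta> \<le> gp x y p" if y: "R' \<le> dist x y" for y
  proof -
    obtain q where q: "dist x q = R'" "gp x y q = R'" using geodesic_point[OF R'(1) y] by blast
    have "q \<in> cball x R'" using q by simp
    then obtain p where p: "p \<in> P" "dist p q < 1" using subsetD[OF P(2), of q] by auto
    then have "R + \<delta> \<le> gp x y p" using gp_perturb_right[of x y q p] q R' by (simp add: dist_commute)
    then show ?thesis using p by blast
  qed
  define B where "B pq = {g \<in> A. R + \<delta> \<le> gp x (g x) (fst pq) \<and> R + \<delta> \<le> gp x (ginv g x) (snd pq)}" for pq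
  have cover: "A \<subseteq> {g \<in> \<Gamma>. dist x (g x) \<le> R'} \<union> (\<Union>pq\<in>P \<times> P. B pq)"
  proof
    fix g assume g: "g \<in> A"
    then have g': "g \<in> \<Gamma>" using A by blast
    show "g \<in> {g \<in> \<Gamma>. dist x (g x) \<le> R'} \<union> (\<Union>pq\<in>P \<times> P. B pq)"
    proof (cases "dist x (g x) \<le> R'")
      case False
      then have "R' \<le> dist x (g x)" "R' \<le> dist x (ginv g x)"
        using dist_act_inv(2)[OF g', of x x] by (auto simp: dist_commute)
      then obtain p q where "p \<in> P" "q \<in> P" "R + \<delta> \<le> gp x (g x) p" "R + \<delta> \<le> gp x (ginv g x) q"
        using net by meson
      then show ?thesis using g by (auto simp: B_def)
    qed (use g' in auto)
  qed
  have "\<exists>pq\<in>P \<times> P. \<not> light \<alpha> (B pq)"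
  proof (rule ccontr)
    assume "\<not> ?thesis"
    then have "light \<alpha> (\<Union>pq\<in>P \<times> P. B pq)"
      using P(1) \<open>0 \<le> \<alpha>\<close> by (intro light_UN) auto
    then have "light \<alpha> ({g \<in> \<Gamma>. dist x (g x) \<le> R'} \<union> (\<Union>pq\<in>P \<times> P. B pq))"
      by (intro light_Un light_finite[OF finite_displacement \<open>0 \<le> \<alpha>\<close>])
    then have "light \<alpha> A" by (rule light_mono[OF _ cover]) (use A in \<open>auto simp: B_def\<close>)
    then show False using A by simp
  qed
  then obtain pq where pq: "\<not> light \<alpha> (B pq)" by blast
  have "R \<le> gp x (g x) (g' x)" "R \<le> gp x (ginv g x) (ginv g' x)" if "g \<in> B pq" "g' \<in> B pq" for g g'
    using hyp_ge[of "R + \<delta>" x "g x" "fst pq" "g' x"] hyp_ge[of "R + \<delta>" x "ginv g x" "snd pq" "ginv g' x"] that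
    by (auto simp: B_def gp_commute[of x "fst pq"] gp_commute[of x "snd pq"])
  moreover have "B pq \<subseteq> A" by (auto simp: B_def)
  ultimately show ?thesis using pq by blast
qed

text \<open>Nested non-light sets make \<open>g x\<close> and \<open>ginv g x\<close> converge to
  two boundary points. If every \<open>f\<close> carried the first to the second, then
  \<open>f = id\<close> shows that they coincide and \<Gamma> fixes this point; linear growth would
  make \<Gamma> light.\<close>

lemma transverse_subset:
  assumes "0 < \<alpha>" "\<not> light \<alpha> \<Gamma>" "non_elementary x \<Gamma>"
  shows "\<exists>f\<in>\<Gamma>. \<exists>A\<subseteq>\<Gamma>. \<exists>c. \<not> light \<alpha> A \<and> (\<forall>g\<in>A. \<forall>g'\<in>A. gp x (ginv g x) (f (g' x)) \<le> c)"
proof (rule ccontr)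
  assume "\<not> ?thesis"
  then have bad: "\<And>f A c. f \<in> \<Gamma> \<Longrightarrow> A \<subseteq> \<Gamma> \<Longrightarrow> \<not> light \<alpha> A \<Longrightarrow> \<exists>g\<in>A. \<exists>g'\<in>A. c < gp x (ginv g x) (f (g' x))"
    by (metis linorder_not_less)
  define good where "good k A \<longleftrightarrow> A \<subseteq> \<Gamma> \<and> \<not> light \<alpha> A \<and>
     (\<forall>g\<in>A. \<forall>g'\<in>A. real k \<le> gp x (g x) (g' x) \<and> real k \<le> gp x (ginv g x) (ginv g' x))" for k A
  have "\<exists>A. \<forall>k. good k (A k) \<and> A (Suc k) \<subseteq> A k"
  proof (rule dependent_nat_choice)
    show "\<exists>A. good 0 A" using assms(2) by (intro exI[of _ \<Gamma>]) (auto simp: good_def gp_nonneg)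
    show "\<exists>B. good (Suc k) B \<and> B \<subseteq> A" if "good k A" for A k
    proof -
      have A: "A \<subseteq> \<Gamma>" "\<not> light \<alpha> A" using that by (auto simp: good_def)
      obtain B where "B \<subseteq> A" "\<not> light \<alpha> B"
        "\<forall>g\<in>B. \<forall>g'\<in>B. real (Suc k) \<le> gp x (g x) (g' x) \<and> real (Suc k) \<le> gp x (ginv g x) (ginv g' x)"
        using refine_not_light[OF A less_imp_le[OF assms(1)], of "real (Suc k)"] by blast
      then show ?thesis using A by (intro exI[of _ B]) (auto simp: good_def)
    qed
  qed
  then obtain A where A: "\<And>k. good k (A k)" "\<And>k. A (Suc k) \<subseteq> A k" by blast
  have "A k \<noteq> {}" for k
    using A(1)[of k] light_finite[of "{}" \<alpha>] assms(1) by (auto simp: good_def)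
  define g where "g k = (SOME g. g \<in> A k)" for k
  have g: "g k \<in> A k" for k
    unfolding g_def using \<open>A k \<noteq> {}\<close> by (simp add: some_in_eq)
  have anti: "g n \<in> A N" if "n \<ge> N" for n N
    using lift_Suc_antimono_le[of A, OF A(2) that] g by blast
  define a where "a k = g k x" for k
  have "gp_to_infinity x a a"
    unfolding gp_to_infinity_def
  proof
    fix C :: real
    obtain N :: nat where N: "C \<le> real N" using real_arch_simple by blast
    have "C \<le> gp x (a n) (a m)" if "n \<ge> N" "m \<ge> N" for n m
      using A(1)[of N] anti[OF that(1)] anti[OF that(2)] N unfolding good_def a_def by fastforce
    then show "\<exists>N. \<forall>n\<ge>N. \<forall>m\<ge>N. C \<le> gp x (a n) (a m)" by blast
  qed
  moreover have "\<forall>\<^sub>F k in sequentially. K \<le> gp x (a k) (f (a k))" if f: "f \<in> \<Gamma>" for f K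
  proof -
    \<comment> \<open>Coarse form of the claim that \<open>h\<close> carries the limit of the
      \<open>a k\<close> to the limit of the inverse points; moving the base point costs
      \<open>dist x (h x)\<close>.\<close>
    have step: "real k - dist x (h x) - 2 * \<delta> \<le> gp x (ginv (g k) x) (h (a k))" if h: "h \<in> \<Gamma>" for h k
    proof -
      have Ak: "A k \<subseteq> \<Gamma>" "\<not> light \<alpha> (A k)"
        "\<And>u v. u \<in> A k \<Longrightarrow> v \<in> A k \<Longrightarrow> real k \<le> gp x (u x) (v x)"
        "\<And>u v. u \<in> A k \<Longrightarrow> v \<in> A k \<Longrightarrow> real k \<le> gp x (ginv u x) (ginv v x)"
        using A(1)[of k] by (auto simp: good_def)
      obtain u v where uv: "u \<in> A k" "v \<in> A k" "real k < gp x (ginv u x) (h (v x))"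
        using bad[OF h Ak(1,2)] by blast
      show ?thesis
      proof (rule hyp_ge4)
        show "real k - dist x (h x) \<le> gp x (ginv (g k) x) (ginv u x)"
          using Ak(4)[OF g uv(1)] by (smt (verit) zero_le_dist)
        show "real k - dist x (h x) \<le> gp x (ginv u x) (h (v x))"
          using uv(3) by (smt (verit) zero_le_dist)
        have "gp (h x) (h (v x)) (h (a k)) = gp x (v x) (a k)" by (rule gp_act[OF h])
        then show "real k - dist x (h x) \<le> gp x (h (v x)) (h (a k))"
          using gp_change_base[of "h x" "h (v x)" "h (a k)" x] Ak(3)[OF uv(2) g] by (simp add: a_def dist_commute)
      qed
    qed
    \<comment> \<open>The case of the identity identifies the two limits, and the case
      \<open>f\<close> then gives invariance under \<open>f\<close>.\<close>
    have "real k - dist x (f x) - 3 * \<delta> \<le> gp x (a k) (f (a k))" for k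
    proof -
      have "real k - dist x (f x) - 2 * \<delta> \<le> gp x (a k) (ginv (g k) x)"
        using step[OF act_id, of k] by (simp add: gp_commute) (smt (verit) zero_le_dist)
      from hyp_ge[OF this step[OF f]] show ?thesis by simp
    qed
    moreover obtain N :: nat where "K + dist x (f x) + 3 * \<delta> \<le> real N" using real_arch_simple by blast
    ultimately have "K \<le> gp x (a k) (f (a k))" if "k \<ge> N" for k
      using that by (smt (verit) of_nat_mono)
    then show ?thesis by (auto simp: eventually_sequentially)
  qed
  ultimately have fd: "fixed_direction a" unfolding fixed_direction_def by blast
  obtain K where K: "\<And>R. \<exists>h\<in>\<Gamma>. R \<le> dist x (h x) \<and> (\<forall>\<^sub>F k in sequentially. gp x (h x) (a k) \<le> K)"
    using limit_set_far[OF _ assms(3), of a] fd unfolding fixed_direction_def by blast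
  have "light \<alpha> \<Gamma>"
    using fixed_direction_linear_growth[OF fd K] linear_growth_light[OF assms(1)] by blast
  then show False using assms(2) by simp
qed

section \<open>Separated sets and Schottky sets\<close>

lemma separated_subset:
  assumes "finite A" "0 < s"
  shows "\<exists>T\<subseteq>A. (\<forall>g\<in>T. \<forall>g'\<in>T. g \<noteq> g' \<longrightarrow> s \<le> dist (g x) (g' x)) \<and> (\<forall>g\<in>A. \<exists>t\<in>T. dist (t x) (g x) < s)"
  using assms(1)
proof (induction A rule: finite_induct)
  case (insert g A)
  from insert.IH obtain T where T: "T \<subseteq> A" "\<forall>g\<in>T. \<forall>g'\<in>T. g \<noteq> g' \<longrightarrow> s \<le> dist (g x) (g' x)"
    "\<forall>g\<in>A. \<exists>t\<in>T. dist (t x) (g x) < s"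
    by (elim exE conjE)
  show ?case
  proof (cases "\<exists>t\<in>T. dist (t x) (g x) < s")
    case True
    then show ?thesis using T by (intro exI[of _ T]) auto
  next
    case False
    then have "\<forall>t\<in>T. s \<le> dist (t x) (g x)" by (simp add: not_less)
    then show ?thesis using T assms(2)
      by (intro exI[of _ "insert g T"]) (auto simp: dist_commute)
  qed
qed simp

text \<open>Left translation by the inverse of \<open>t\<close> embeds the elements near
  \<open>t\<close> into those of displacement at most \<open>s\<close>.\<close>

lemma card_le_separated:
  assumes "finite T" "T \<subseteq> \<Gamma>" "A \<subseteq> \<Gamma>" "\<And>g. g \<in> A \<Longrightarrow> \<exists>t\<in>T. dist (t x) (g x) < s"
  shows "card A \<le> card T * card {g \<in> \<Gamma>. dist x (g x) \<le> s}"
proof -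
  let ?N = "{g \<in> \<Gamma>. dist x (g x) \<le> s}"
  have fin: "finite ?N" by (rule finite_displacement)
  have *: "card {g \<in> \<Gamma>. dist (t x) (g x) < s} \<le> card ?N \<and> finite {g \<in> \<Gamma>. dist (t x) (g x) < s}"
    if t: "t \<in> T" for t
  proof -
    have tG: "t \<in> \<Gamma>" using t assms(2) by blast
    let ?f = "\<lambda>g. ginv t \<circ> g"
    have "inj_on ?f {g \<in> \<Gamma>. dist (t x) (g x) < s}"
    proof (rule inj_onI)
      fix g g' assume "?f g = ?f g'"
      then have "\<And>p. t (ginv t (g p)) = t (ginv t (g' p))" by (metis comp_apply)
      then show "g = g'" using act_f_inv[OF tG] by (metis ext)
    qed
    moreover have "?f ` {g \<in> \<Gamma>. dist (t x) (g x) < s} \<subseteq> ?N"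
      using act_comp[OF act_inv[OF tG]] dist_act_inv(2)[OF tG] by auto
    ultimately show ?thesis using fin by (meson card_inj_on_le inj_on_finite)
  qed
  have "card A \<le> card (\<Union>t\<in>T. {g \<in> \<Gamma>. dist (t x) (g x) < s})"
    using assms * by (intro card_mono finite_UN_I) auto
  also have "\<dots> \<le> (\<Sum>t\<in>T. card {g \<in> \<Gamma>. dist (t x) (g x) < s})" by (rule card_UN_le) fact
  also have "\<dots> \<le> (\<Sum>t\<in>T. card ?N)" using * by (intro sum_mono) blast
  also have "\<dots> = card T * card ?N" by simp
  finally show ?thesis .
qed

text \<open>\<open>c\<close> bounds the cancellation between consecutive letters, and letters of
  length at least \<open>L\<close> then give quasi-geodesic words. The separation is what
  \<open>path_branching\<close> needs to make different words diverge.\<close>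

definition schottky_set :: "('a \<Rightarrow> 'a) set \<Rightarrow> real \<Rightarrow> real \<Rightarrow> real \<Rightarrow> bool" where
  "schottky_set S c L D \<longleftrightarrow> finite S \<and> S \<subseteq> \<Gamma> \<and> 0 \<le> c \<and> 0 < D \<and> 2 * c + 4 * \<delta> + 1 \<le> L \<and>
     (\<forall>g\<in>S. L \<le> dist x (g x) \<and> dist x (g x) \<le> D) \<and>
     (\<forall>g\<in>S. \<forall>g'\<in>S. gp x (ginv g x) (g' x) \<le> c) \<and>
     (\<forall>g\<in>S. \<forall>g'\<in>S. g \<noteq> g' \<longrightarrow> D - L + 2 * c + 8 * \<delta> + 1 \<le> dist (g x) (g' x))"

lemma schottky_set_exists:
  assumes "0 < \<alpha>" "\<not> light \<alpha> \<Gamma>" "non_elementary x \<Gamma>"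
  shows "\<exists>S c L D. schottky_set S c L D \<and> exp (\<alpha> * D) < real (card S)"
proof -
  obtain f A c0 where f: "f \<in> \<Gamma>" and A: "A \<subseteq> \<Gamma>" "\<not> light \<alpha> A"
    and c0: "\<And>g g'. g \<in> A \<Longrightarrow> g' \<in> A \<Longrightarrow> gp x (ginv g x) (f (g' x)) \<le> c0"
    using transverse_subset[OF assms] by blast
  define F where "F = dist x (f x)"
  \<comment> \<open>The extra \<delta> is spent on passing from \<open>ginv g x\<close> to the
    inverse image of \<open>x\<close> under \<open>f \<circ> g\<close>.\<close>
  define c where "c = max 0 c0 + \<delta>"
  have F: "0 \<le> F" by (simp add: F_def)
  have c: "0 \<le> c" "c0 + \<delta> \<le> c" using delta_nonneg by (auto simp: c_def)
  \<comment> \<open>Equals \<open>D - L + 2 * c + 8 * \<delta> + 1\<close> for the \<open>D\<close>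
    and \<open>L\<close> defined below, since \<open>D - L = 1 + 2 * F\<close>.\<close>
  define s where "s = 1 + 2 * F + 2 * c + 8 * \<delta> + 1"
  have s: "0 < s" using F c delta_nonneg by (simp add: s_def)
  define N where "N = card {g \<in> \<Gamma>. dist x (g x) \<le> s}"
  obtain n0 :: nat where n0: "F + 2 * c + 4 * \<delta> + 1 \<le> real n0" using real_arch_simple by blast
  \<comment> \<open>The first term compensates for the loss \<open>N\<close> in separating the
    annulus and for \<open>D - real n\<close>; the second forces \<open>n\<close> to be at least
    \<open>n0\<close>.\<close>
  define C where "C = max (real N * exp (\<alpha> * (1 + F))) (real (card {g \<in> \<Gamma>. dist x (g x) \<le> real n0}))"
  obtain n where n: "C * exp (\<alpha> * real n) < real (card (annulus A n))"
    using A(2) by (auto simp: light_def not_le)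
  have "n0 \<le> n"
  proof (rule ccontr)
    assume "\<not> n0 \<le> n"
    then have "card (annulus A n) \<le> card {g \<in> \<Gamma>. dist x (g x) \<le> real n0}"
      using A(1) by (intro card_mono finite_displacement) (auto simp: annulus_def)
    then have "real (card (annulus A n)) \<le> C * 1" by (simp add: C_def)
    also have "\<dots> \<le> C * exp (\<alpha> * real n)" using assms(1) by (intro mult_left_mono) (auto simp: C_def)
    finally show False using n by simp
  qed
  then have n_large: "F + 2 * c + 4 * \<delta> + 1 \<le> real n" using n0 by linarith
  from separated_subset[OF finite_annulus[OF A(1)] s, of n]
  obtain T where T0: "T \<subseteq> annulus A n"
    "\<forall>g\<in>T. \<forall>g'\<in>T. g \<noteq> g' \<longrightarrow> s \<le> dist (g x) (g' x)"
    "\<forall>g\<in>annulus A n. \<exists>t\<in>T. dist (t x) (g x) < s"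
    by (elim exE conjE)
  note T = T0(1) T0(2)[rule_format] T0(3)[rule_format]
  have TA: "g \<in> A" "g \<in> \<Gamma>" "real n \<le> dist x (g x)" "dist x (g x) < real n + 1" if "g \<in> T" for g
    using that T(1) A(1) by (auto simp: annulus_def)
  have finT: "finite T" using T(1) finite_annulus[OF A(1)] by (rule finite_subset)
  define L where "L = real n - F"
  define D where "D = real n + 1 + F"
  let ?S = "(\<lambda>g. f \<circ> g) ` T"
  have "card (annulus A n) \<le> card T * N"
    unfolding N_def using T A finT TA by (intro card_le_separated) (auto simp: annulus_def)
  then have "real (card (annulus A n)) \<le> real (card T) * real N" by (metis of_nat_mono of_nat_mult)
  moreover have "real N * exp (\<alpha> * D) \<le> C * exp (\<alpha> * real n)"
  proof -
    have "real N * exp (\<alpha> * D) = (real N * exp (\<alpha> * (1 + F))) * exp (\<alpha> * real n)"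
      by (simp add: D_def exp_add[symmetric] algebra_simps)
    also have "\<dots> \<le> C * exp (\<alpha> * real n)" by (intro mult_right_mono) (auto simp: C_def)
    finally show ?thesis .
  qed
  ultimately have "real N * exp (\<alpha> * D) < real N * real (card T)" using n by (simp add: mult.commute)
  then have "exp (\<alpha> * D) < real (card T)" by (simp add: mult_less_cancel_left)
  moreover have "inj_on (\<lambda>g. f \<circ> g) T"
  proof (rule inj_onI)
    fix g g' assume "f \<circ> g = f \<circ> g'"
    then have "\<And>p. ginv f (f (g p)) = ginv f (f (g' p))" by (metis comp_apply)
    then show "g = g'" using act_inv_f[OF f] by (metis ext)
  qed
  ultimately have card: "exp (\<alpha> * D) < real (card ?S)" by (simp add: card_image)
  have "schottky_set ?S c L D"
    unfolding schottky_set_def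
  proof (intro conjI ballI impI)
    show "finite ?S" using finT by simp
    show "?S \<subseteq> \<Gamma>" using act_comp[OF f] TA(2) by blast
    show "0 \<le> c" "0 < D" "2 * c + 4 * \<delta> + 1 \<le> L" using c F n_large by (auto simp: D_def L_def)
  next
    fix h assume "h \<in> ?S"
    then obtain g where g: "g \<in> T" "h = f \<circ> g" by blast
    have "dist (f x) (f (g x)) = dist x (g x)" by (rule dist_act[OF f])
    then show "L \<le> dist x (h x)" "dist x (h x) \<le> D"
      using dist_triangle[of "f x" "f (g x)" x] dist_triangle[of x "f (g x)" "f x"] TA(3,4)[OF g(1)]
      by (auto simp: g(2) L_def D_def F_def dist_commute)
  next
    fix h h' assume "h \<in> ?S" "h' \<in> ?S"
    then obtain g g' where g: "g \<in> T" "h = f \<circ> g" and g': "g' \<in> T" "h' = f \<circ> g'" by blast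
    have "ginv h x = ginv g (ginv f x)"
      using o_inv_distrib[OF bij_act[OF f] bij_act[OF TA(2)[OF g(1)]]] g(2) by (metis comp_apply)
    moreover have "dist (ginv g x) (ginv g (ginv f x)) = F"
      using dist_act[OF act_inv[OF TA(2)[OF g(1)]]] dist_act_inv(2)[OF f] by (simp add: F_def dist_commute)
    \<comment> \<open>The inverse images of \<open>x\<close> under \<open>g\<close> and
      \<open>f \<circ> g\<close> are \<open>F\<close> apart, so seen from \<open>x\<close> they
      agree beyond depth \<open>c\<close>.\<close>
    ultimately have "real n - F \<le> gp x (ginv g x) (ginv h x)"
      using gp_perturb_right[of x "ginv g x" "ginv g x" "ginv h x"] TA(3)[OF g(1)]
        dist_act_inv(2)[OF TA(2)[OF g(1)], of x x]
      by (simp add: gp_self dist_commute)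
    then have "c < gp x (ginv g x) (ginv h x)" using n_large c delta_nonneg by linarith
    then show "gp x (ginv h x) (h' x) \<le> c"
      using hyp[of x "ginv g x" "ginv h x" "f (g' x)"] c0[OF TA(1)[OF g(1)] TA(1)[OF g'(1)]] c
      by (auto simp: g'(2) min_def split: if_splits)
    assume "h \<noteq> h'"
    then have "g \<noteq> g'" using g g' by blast
    then show "D - L + 2 * c + 8 * \<delta> + 1 \<le> dist (h x) (h' x)"
      using T(2)[OF g(1) g'(1)] dist_act[OF f, of "g x" "g' x"] by (simp add: g(2) g'(2) s_def D_def L_def)
  qed
  then show ?thesis using card by blast
qed

end

section \<open>Quasi-geodesic sequences and the rays along them\<close>

text \<open>Tychonoff for pointwise convergence; \<open>max 0 t\<close> keeps the balls nonempty at
  negative times.\<close>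

lemma compact_functions_in_cball:
  assumes "proper_space TYPE('a::metric_space)"
  shows "compact {f :: real \<Rightarrow> 'a. \<forall>t. f t \<in> cball x (max 0 t)}"
proof -
  have "compactin (product_topology (\<lambda>_. euclidean) UNIV) (PiE UNIV (\<lambda>t. cball x (max 0 t)))"
    using assms by (subst compactin_PiE) (auto simp: proper_space_def)
  then show ?thesis
    by (simp add: euclidean_product_topology PiE_UNIV_domain Pi_def)
qed

context gromov_hyperbolic
begin

context
  fixes y :: "nat \<Rightarrow> 'a" and c L :: real
  assumes c: "0 \<le> c" and L: "2 * c + 4 * \<delta> + 1 \<le> L"
    and turn: "\<And>n. gp (y (Suc n)) (y n) (y (Suc (Suc n))) \<le> c"
    and step: "\<And>n. L \<le> dist (y n) (y (Suc n))"
begin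

text \<open>The last step is long and by induction turns little, so from its end the start and the
  previous point agree beyond c + \<delta>. The bound for the next turn then carries over to the
  start with loss \<delta>.\<close>

lemma chain_last:
  "gp (y (i + n)) (y i) (y (Suc (i + n))) \<le> c + \<delta>"
proof (induction n)
  case 0
  have "gp (y i) (y i) (y (Suc i)) = 0" by (simp add: gromov_product_def)
  then show ?case using c delta_nonneg by simp
next
  case (Suc n)
  let ?w = "y (Suc (i + n))"
  have "c + \<delta> < gp ?w (y (i + n)) (y i)"
    using gp_add_gp[of "y (i + n)" ?w "y i"] step[of "i + n"] Suc L delta_nonneg
    by (simp add: gp_commute[of _ _ "y i"])
  then show ?case
    using hyp[of ?w "y (i + n)" "y i" "y (Suc (Suc (i + n)))"] turn[of "i + n"]
    by (auto simp: min_def split: if_splits)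
qed

text \<open>Mirror image of \<open>chain_last\<close>; \<open>i\<close> is generalised because the
  induction removes the first point.\<close>

lemma chain_first:
  "gp (y (Suc i)) (y i) (y (Suc i + d)) \<le> c + \<delta>"
proof (induction d arbitrary: i)
  case 0
  have "gp (y (Suc i)) (y i) (y (Suc i)) = 0" by (simp add: gromov_product_def dist_commute)
  then show ?case using c delta_nonneg by simp
next
  case (Suc d)
  let ?w = "y (Suc i)" and ?p = "y (Suc (Suc i) + d)"
  have "c + \<delta> < gp ?w ?p (y (Suc (Suc i)))"
    using gp_add_gp[of ?w "y (Suc (Suc i))" ?p] step[of "Suc i"] Suc[of "Suc i"] L delta_nonneg
    by (simp add: gp_commute)
  then show ?case
    using hyp[of ?w "y i" ?p "y (Suc (Suc i))"] turn[of i]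
    by (auto simp: min_def split: if_splits)
qed

lemma chain_middle:
  assumes "i \<le> j" "j \<le> k"
  shows "gp (y j) (y i) (y k) \<le> c + 2 * \<delta>"
proof (cases "j = k")
  case True
  have "gp (y k) (y i) (y k) = 0" by (simp add: gromov_product_def dist_commute)
  then show ?thesis using True c delta_nonneg by simp
next
  case False
  then obtain d where d: "k = Suc j + d" using assms(2) less_imp_Suc_add[of j k] by auto
  obtain n where n: "j = i + n" using assms(1) le_Suc_ex by blast
  have "c + 2 * \<delta> < gp (y j) (y k) (y (Suc j))"
    using gp_add_gp[of "y j" "y (Suc j)" "y k"] step[of j] chain_first[of j d] L d delta_nonneg
    by (simp add: gp_commute)
  then show ?thesis
    using hyp[of "y j" "y i" "y k" "y (Suc j)"] chain_last[of i n] n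
    by (auto simp: min_def split: if_splits)
qed

lemma chain_dist_Suc: "dist (y 0) (y n) + 1 \<le> dist (y 0) (y (Suc n))"
  using dist_eq_gp[of "y 0" "y (Suc n)" "y n"] step[of n] chain_last[of 0 n] L delta_nonneg
  by (simp add: dist_commute)

lemma chain_dist_ge: "real n \<le> dist (y 0) (y n)"
proof (induction n)
  case (Suc n)
  then show ?case using chain_dist_Suc[of n] by simp
qed simp

lemma chain_dist_mono:
  assumes "n \<le> m"
  shows "dist (y 0) (y n) \<le> dist (y 0) (y m)"
  using _ assms
proof (rule lift_Suc_mono_le[of "\<lambda>n. dist (y 0) (y n)"])
  show "dist (y 0) (y n) \<le> dist (y 0) (y (Suc n))" for n
    using chain_dist_Suc[of n] by simp
qed

lemma chain_gp_ge: "real (min n m) - (c + 2 * \<delta>) \<le> gp (y 0) (y n) (y m)"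
proof -
  have *: "real n - (c + 2 * \<delta>) \<le> gp (y 0) (y n) (y m)" if "n \<le> m" for n m
    using gp_add_gp[of "y 0" "y n" "y m"] chain_middle[of 0 n m] chain_dist_ge[of n] that by simp
  show ?thesis
    using *[of n m] *[of m n] by (cases "n \<le> m") (auto simp: gp_commute)
qed

end

text \<open>Geodesic segments from \<open>x\<close> to \<open>y N\<close> with \<open>N\<close>
  large satisfy any finite number of the closed conditions \<open>T i\<close>; compactness yields
  one function satisfying all of them.\<close>

lemma ray_along:
  assumes proper: "proper_space TYPE('a)"
    and mid: "\<And>i j. i \<le> j \<Longrightarrow> gp (y i) x (y j) \<le> c"
    and mono: "\<And>i j. i \<le> j \<Longrightarrow> dist x (y i) \<le> dist x (y j)"
    and far: "\<And>n. real n \<le> dist x (y n)"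
  shows "\<exists>\<xi>. geodesic_ray \<xi> \<and> \<xi> 0 = x \<and> (\<forall>n. dist (\<xi> (dist x (y n))) (y n) \<le> 2 * c + 2 * \<delta>)"
proof -
  let ?K = "{f :: real \<Rightarrow> 'a. \<forall>t. f t \<in> cball x (max 0 t)}"
  \<comment> \<open>A triple encodes two conditions: the distance of the values at \<open>s\<close>
    and \<open>t\<close>, and closeness to \<open>y n\<close>.\<close>
  define I :: "(real \<times> real \<times> nat) set" where "I = {(s, t, n). 0 \<le> s \<and> 0 \<le> t}"
  define T where "T i = (case i of (s, t, n) \<Rightarrow> {f :: real \<Rightarrow> 'a. dist (f s) (f t) = \<bar>s - t\<bar> \<and>
    dist (f (dist x (y n))) (y n) \<le> 2 * c + 2 * \<delta>})" for i
  have "?K \<inter> (\<Inter>i\<in>I. T i) \<noteq> {}"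
  proof (rule compact_imp_fip_image)
    show "compact ?K" using proper by (rule compact_functions_in_cball)
    show "closed (T i)" for i
    proof -
      obtain s t n where i: "i = (s, t, n)" by (metis prod_cases3)
      show ?thesis unfolding i T_def prod.case
        by (intro closed_Collect_conj closed_Collect_eq closed_Collect_le continuous_intros
            continuous_on_product_coordinates)
    qed
    fix J assume J: "finite J" "J \<subseteq> I"
    define M where "M = (\<Sum>(s, t, n)\<in>J. \<bar>s\<bar> + \<bar>t\<bar> + real n)"
    have M: "\<bar>s\<bar> + \<bar>t\<bar> + real n \<le> M" if "(s, t, n) \<in> J" for s t n
      unfolding M_def using member_le_sum[OF that, of "\<lambda>(s, t, n). \<bar>s\<bar> + \<bar>t\<bar> + real n"] J(1) by auto
    obtain N :: nat where N: "M \<le> real N" using real_arch_simple by blast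
    define d where "d = dist x (y N)"
    have dN: "M \<le> d" using far[of N] N by (simp add: d_def)
    obtain \<gamma> :: "real \<Rightarrow> 'a" where \<gamma>: "\<gamma> 0 = x" "\<gamma> d = y N"
      "\<And>s t. s \<in> {0..d} \<Longrightarrow> t \<in> {0..d} \<Longrightarrow> dist (\<gamma> s) (\<gamma> t) = \<bar>s - t\<bar>"
      using geodesic unfolding geodesic_space_def d_def by metis
    \<comment> \<open>The default value \<open>x\<close> off the segment keeps \<open>g\<close> in
      the compact set.\<close>
    define g where "g t = (if t \<in> {0..d} then \<gamma> t else x)" for t
    have "g \<in> ?K"
      using \<gamma>(3)[of 0] \<gamma>(1) by (auto simp: g_def)
    moreover have "g \<in> T i" if i: "i \<in> J" for i
    proof -
      obtain s t n where stn: "i = (s, t, n)" by (metis prod_cases3)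
      have st: "0 \<le> s" "0 \<le> t" using i J(2) stn by (auto simp: I_def)
      have le: "s \<le> d" "t \<le> d" "real n \<le> real N" using M[of s t n] i stn st dN N by auto
      then have nN: "n \<le> N" by simp
      define r where "r = dist x (y n)"
      have r: "0 \<le> r" "r \<le> d" using mono[OF nN] by (auto simp: r_def d_def)
      have "dist x (g r) = r" "dist (y N) (g r) = d - r"
        using \<gamma>(3)[of 0 r] \<gamma>(3)[of d r] r by (auto simp: g_def \<gamma>(1,2))
      then have gr: "dist x (g r) = r" "gp x (g r) (y N) = r"
        by (simp_all add: gromov_product_def d_def[symmetric] dist_commute)
      have "r - c \<le> gp x (y N) (y n)"
        using gp_add_gp[of x "y n" "y N"] mid[OF nN] by (simp add: r_def gp_commute)
      moreover have "0 \<le> c" using mid[OF nN] gp_nonneg order_trans by blast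
      ultimately have "r - c - \<delta> \<le> gp x (g r) (y n)" using gr by (intro hyp_ge) auto
      then have "dist (g r) (y n) \<le> 2 * c + 2 * \<delta>"
        using dist_eq_gp[of "g r" "y n" x] gr by (simp add: r_def)
      moreover have "dist (g s) (g t) = \<bar>s - t\<bar>" using \<gamma>(3)[of s t] st le by (simp add: g_def)
      ultimately show ?thesis by (simp add: T_def stn r_def)
    qed
    ultimately show "?K \<inter> (\<Inter>i\<in>J. T i) \<noteq> {}" by blast
  qed
  then obtain \<xi> where \<xi>: "\<And>t. \<xi> t \<in> cball x (max 0 t)" "\<And>i. i \<in> I \<Longrightarrow> \<xi> \<in> T i" by auto
  have "\<xi> 0 = x" using \<xi>(1)[of 0] by simp
  moreover have "geodesic_ray \<xi>"
    unfolding geodesic_ray_def using \<xi>(2)[of "(_, _, 0)"] by (auto simp: I_def T_def)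
  moreover have "dist (\<xi> (dist x (y n))) (y n) \<le> 2 * c + 2 * \<delta>" for n
    using \<xi>(2)[of "(0, 0, n)"] by (auto simp: I_def T_def)
  ultimately show ?thesis by blast
qed

lemma ray_endpoint_along:
  assumes "geodesic_ray \<xi>" "\<xi> 0 = x" "y \<in> gromov_seqs x"
    and "\<And>n. dist (\<xi> (dist x (y n))) (y n) \<le> \<tau>" and "\<And>n. real n \<le> dist x (y n)"
  shows "ray_endpoint x \<xi> = gromov_rel x `` {y}"
proof (rule boundary_eqI[OF ray_endpoint_boundary(1)[OF assms(1,2)] class_in_boundary(1)[OF assms(3)]
      ray_endpoint_boundary(2)[OF assms(1,2)] class_in_boundary(2)[OF assms(3)]], unfold gp_to_infinity_def, rule allI)
  fix C
  obtain N :: nat where N: "C + \<tau> \<le> real N" using real_arch_simple by blast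
  have "C \<le> gp x (\<xi> (real n)) (y m)" if "n \<ge> N" "m \<ge> N" for n m
  proof -
    have "min (real n) (dist x (y m)) \<le> gp x (\<xi> (real n)) (y m) + \<tau>"
      using gp_perturb_right[of x "\<xi> (real n)" "\<xi> (dist x (y m))" "y m"] assms(4)[of m]
        gp_ray[OF assms(1,2), of "real n" "dist x (y m)"] by simp
    moreover have "real N \<le> real n" "real N \<le> dist x (y m)" using that assms(5)[of m] by linarith+
    ultimately show ?thesis using N by (simp add: min_def split: if_splits)
  qed
  then show "\<exists>N. \<forall>n\<ge>N. \<forall>m\<ge>N. C \<le> gp x (\<xi> (real n)) (y m)" by blast
qed

end

section \<open>The lower bound\<close>

text \<open>Letters are appended on the right, so that prefixes of a code give successive vertices
  of a path in the orbit, with step lengths equal to the displacements of the letters.\<close>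

fun word :: "(nat \<Rightarrow> 'a \<Rightarrow> 'a) \<Rightarrow> nat \<Rightarrow> 'a \<Rightarrow> 'a" where
  "word \<sigma> 0 = id"
| "word \<sigma> (Suc n) = word \<sigma> n \<circ> \<sigma> n"

lemma word_cong: "(\<And>i. i < n \<Longrightarrow> \<sigma> i = \<tau> i) \<Longrightarrow> word \<sigma> n = word \<tau> n"
  by (induction n) auto

locale schottky_action = discrete_action x \<delta> \<Gamma> for x :: "'a::metric_space" and \<delta> \<Gamma> +
  fixes S :: "('a \<Rightarrow> 'a) set" and c L D :: real
  assumes schottky: "schottky_set S c L D"
begin

lemmas schottky_conjs = schottky[unfolded schottky_set_def]

lemma S_finite: "finite S"
  and S_sub: "S \<subseteq> \<Gamma>"
  and c_nonneg: "0 \<le> c"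
  and D_pos: "0 < D"
  and L_ge: "2 * c + 4 * \<delta> + 1 \<le> L"
  using schottky_conjs by simp_all

lemma S_len:
  assumes "g \<in> S"
  shows "L \<le> dist x (g x)" "dist x (g x) \<le> D"
  using schottky_conjs assms by simp_all

lemma S_gp:
  assumes "g \<in> S" "g' \<in> S"
  shows "gp x (ginv g x) (g' x) \<le> c"
  using schottky_conjs assms by simp

lemma S_sep:
  assumes "g \<in> S" "g' \<in> S" "g \<noteq> g'"
  shows "D - L + 2 * c + 8 * \<delta> + 1 \<le> dist (g x) (g' x)"
  using schottky_conjs assms by simp

section \<open>Codes, their orbit paths and limits\<close>

definition codes :: "(nat \<Rightarrow> 'a \<Rightarrow> 'a) set" where
  "codes = {\<sigma>. \<forall>n. \<sigma> n \<in> S}"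

lemma codesD: "\<sigma> \<in> codes \<Longrightarrow> \<sigma> n \<in> S"
  by (simp add: codes_def)

definition orbit_path :: "(nat \<Rightarrow> 'a \<Rightarrow> 'a) \<Rightarrow> nat \<Rightarrow> 'a" where
  "orbit_path \<sigma> n = word \<sigma> n x"

lemma path_0: "orbit_path \<sigma> 0 = x"
  by (simp add: orbit_path_def)

lemma word_in_group: "\<sigma> \<in> codes \<Longrightarrow> word \<sigma> n \<in> \<Gamma>"
proof (induction n)
  case (Suc n)
  then have "word \<sigma> n \<in> \<Gamma>" "\<sigma> n \<in> \<Gamma>" using codesD[of \<sigma> n] S_sub by auto
  then show ?case unfolding word.simps by (rule act_comp)
next
  case 0
  show ?case unfolding word.simps by (rule act_id)
qed

lemma path_step: "\<sigma> \<in> codes \<Longrightarrow> dist (orbit_path \<sigma> n) (orbit_path \<sigma> (Suc n)) = dist x (\<sigma> n x)"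
  using dist_act[OF word_in_group, of \<sigma> n x] by (simp add: orbit_path_def)

text \<open>Translating the middle vertex back to \<open>x\<close> turns its neighbours into
  \<open>ginv (\<sigma> n) x\<close> and \<open>\<sigma> (Suc n) x\<close>.\<close>

lemma path_turn:
  assumes \<sigma>: "\<sigma> \<in> codes"
  shows "gp (orbit_path \<sigma> (Suc n)) (orbit_path \<sigma> n) (orbit_path \<sigma> (Suc (Suc n))) \<le> c"
proof -
  have "\<sigma> n \<in> \<Gamma>" using codesD[OF \<sigma>] S_sub by blast
  then have "orbit_path \<sigma> n = word \<sigma> (Suc n) (ginv (\<sigma> n) x)" by (simp add: orbit_path_def act_f_inv)
  moreover have "orbit_path \<sigma> (Suc (Suc n)) = word \<sigma> (Suc n) (\<sigma> (Suc n) x)"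
    "orbit_path \<sigma> (Suc n) = word \<sigma> (Suc n) x" by (simp_all add: orbit_path_def)
  ultimately show ?thesis
    using gp_act[OF word_in_group[OF \<sigma>, of "Suc n"], of x "ginv (\<sigma> n) x" "\<sigma> (Suc n) x"]
      S_gp[OF codesD[OF \<sigma>] codesD[OF \<sigma>], of n "Suc n"]
    by (simp del: word.simps)
qed

context
  fixes \<sigma> assumes \<sigma>: "\<sigma> \<in> codes"
begin

lemma path_steps: "L \<le> dist (orbit_path \<sigma> n) (orbit_path \<sigma> (Suc n))" "dist (orbit_path \<sigma> n) (orbit_path \<sigma> (Suc n)) \<le> D"
  using S_len[OF codesD[OF \<sigma>]] by (simp_all add: path_step[OF \<sigma>])

lemmas path_middle = chain_middle[of c L "orbit_path \<sigma>", OF c_nonneg L_ge path_turn[OF \<sigma>] path_steps(1)]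
lemmas path_dist_ge = chain_dist_ge[of c L "orbit_path \<sigma>", OF c_nonneg L_ge path_turn[OF \<sigma>] path_steps(1), unfolded path_0]
lemmas path_dist_mono = chain_dist_mono[of c L "orbit_path \<sigma>", OF c_nonneg L_ge path_turn[OF \<sigma>] path_steps(1), unfolded path_0]
lemmas path_gp_ge = chain_gp_ge[of c L "orbit_path \<sigma>", OF c_nonneg L_ge path_turn[OF \<sigma>] path_steps(1), unfolded path_0]

lemma path_dist_le: "dist x (orbit_path \<sigma> n) \<le> real n * D"
proof (induction n)
  case (Suc n)
  then show ?case using dist_triangle[of x "orbit_path \<sigma> (Suc n)" "orbit_path \<sigma> n"] path_steps(2)[of n]
    by (simp add: distrib_right)
qed (simp add: path_0)

lemma path_gromov_seq: "orbit_path \<sigma> \<in> gromov_seqs x"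
  unfolding gromov_seqs_iff gp_to_infinity_def
proof
  fix C
  obtain N :: nat where N: "C + c + 2 * \<delta> \<le> real N" using real_arch_simple by blast
  have "C \<le> gp x (orbit_path \<sigma> n) (orbit_path \<sigma> m)" if "n \<ge> N" "m \<ge> N" for n m
  proof -
    have "real N \<le> real (min n m)" using that by simp
    then show ?thesis using path_gp_ge[of n m] N by linarith
  qed
  then show "\<exists>N. \<forall>n\<ge>N. \<forall>m\<ge>N. C \<le> gp x (orbit_path \<sigma> n) (orbit_path \<sigma> m)" by blast
qed

end

definition limit :: "(nat \<Rightarrow> 'a \<Rightarrow> 'a) \<Rightarrow> 'a bdry_point" where
  "limit \<sigma> = gromov_rel x `` {orbit_path \<sigma>}"

lemma limit_boundary: "\<sigma> \<in> codes \<Longrightarrow> limit \<sigma> \<in> gromov_boundary x" "\<sigma> \<in> codes \<Longrightarrow> orbit_path \<sigma> \<in> limit \<sigma>"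
  using class_in_boundary[OF path_gromov_seq] by (simp_all add: limit_def)

text \<open>Steps have length at most \<open>D\<close>, so the path has a vertex at a distance from
  \<open>x\<close> in each interval of the arithmetic progression \<theta>, and the ray follows the
  path at bounded distance.\<close>

lemma limit_ergodic:
  assumes \<sigma>: "\<sigma> \<in> codes"
  shows "limit \<sigma> \<in> ergodic_limit_set x \<Gamma>"
proof -
  define \<tau> where "\<tau> = 2 * (c + 2 * \<delta>) + 2 * \<delta> + 1"
  define \<theta> where "\<theta> i = D * real i" for i
  have \<tau>: "0 < \<tau>" using c_nonneg delta_nonneg by (simp add: \<tau>_def)
  have "\<theta> \<in> theta_erg"
  proof -
    have "strict_mono \<theta>" using D_pos by (auto simp: strict_mono_def \<theta>_def)
    moreover have "filterlim \<theta> at_top sequentially"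
      unfolding \<theta>_def using D_pos by real_asymp
    moreover have "(\<lambda>i. \<theta> i / real i) \<longlonglongrightarrow> D"
      unfolding \<theta>_def using D_pos by real_asymp
    ultimately show ?thesis using D_pos unfolding theta_erg_def by blast
  qed
  moreover have "limit \<sigma> \<in> tau_theta_limit_set x \<Gamma> \<tau> \<theta>"
  proof -
    let ?y = "orbit_path \<sigma>"
    have mid: "gp (?y i) x (?y j) \<le> c + 2 * \<delta>" if "i \<le> j" for i j
      using path_middle[OF \<sigma>, of 0 i j] that by (simp add: path_0)
    obtain \<xi> where \<xi>: "geodesic_ray \<xi>" "\<xi> 0 = x"
      and near: "\<And>n. dist (\<xi> (dist x (?y n))) (?y n) \<le> 2 * (c + 2 * \<delta>) + 2 * \<delta>"
      using ray_along[OF proper mid path_dist_mono[OF \<sigma>] path_dist_ge[OF \<sigma>]] by blast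
    have "ray_endpoint x \<xi> = limit \<sigma>"
      unfolding limit_def by (rule ray_endpoint_along[OF \<xi> path_gromov_seq[OF \<sigma>] near path_dist_ge[OF \<sigma>]])
    moreover have "\<exists>p\<in>\<xi> ` {0..}. dist x p \<in> {\<theta> i..\<theta> (Suc i)} \<and> infdist p (isom_orbit \<Gamma> x) \<le> \<tau>" for i
    proof -
      obtain N :: nat where "\<theta> i \<le> real N" using real_arch_simple by blast
      then have ex: "\<exists>j. \<theta> i \<le> dist x (?y j)" using path_dist_ge[OF \<sigma>, of N] by (intro exI[of _ N]) simp
      \<comment> \<open>The first vertex beyond \<open>\<theta> i\<close> overshoots by at most one
        step.\<close>
      define j where "j = (LEAST j. \<theta> i \<le> dist x (?y j))"
      have j: "\<theta> i \<le> dist x (?y j)" "\<And>k. k < j \<Longrightarrow> dist x (?y k) < \<theta> i"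
        using LeastI_ex[OF ex] not_less_Least unfolding j_def by (auto simp: not_le[symmetric])
      have "dist x (?y j) \<le> \<theta> i + D"
      proof (cases j)
        case 0
        then show ?thesis using D_pos by (simp add: path_0 \<theta>_def)
      next
        case (Suc k)
        then show ?thesis
          using j(2)[of k] dist_triangle[of x "?y j" "?y k"] path_steps(2)[OF \<sigma>, of k] by simp
      qed
      then have "dist x (?y j) \<in> {\<theta> i..\<theta> (Suc i)}" using j(1) by (simp add: \<theta>_def algebra_simps)
      moreover have "dist x (\<xi> (dist x (?y j))) = dist x (?y j)" using dist_ray[OF \<xi>] by simp
      moreover have "infdist (\<xi> (dist x (?y j))) (isom_orbit \<Gamma> x) \<le> \<tau>"
      proof (rule infdist_le2)
        show "?y j \<in> isom_orbit \<Gamma> x"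
          using word_in_group[OF \<sigma>] by (auto simp: isom_orbit_def orbit_path_def)
        show "dist (\<xi> (dist x (?y j))) (?y j) \<le> \<tau>" using near[of j] by (simp add: \<tau>_def)
      qed
      ultimately show ?thesis by (intro bexI[of _ "\<xi> (dist x (?y j))"]) auto
    qed
    ultimately show ?thesis
      using \<xi> limit_boundary(1)[OF \<sigma>] unfolding tau_theta_limit_set_def by blast
  qed
  ultimately show ?thesis using \<tau> unfolding ergodic_limit_set_def by blast
qed

text \<open>At the branching point \<open>w\<close>, late vertices of each path lie in nearly the
  direction of its next vertex. A product above \<open>D\<close> at \<open>w\<close> would then
  force the two next vertices to be closer than the separation of \<open>S\<close> permits.\<close>

lemma path_branching:
  assumes \<sigma>: "\<sigma> \<in> codes" and \<tau>: "\<tau> \<in> codes"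
    and agree: "\<And>k. k < p \<Longrightarrow> \<sigma> k = \<tau> k" and diff: "\<sigma> p \<noteq> \<tau> p" and ij: "p < i" "p < j"
  shows "gp x (orbit_path \<sigma> i) (orbit_path \<tau> j) \<le> real (Suc p) * D"
proof -
  define w where "w = orbit_path \<sigma> p"
  have w: "word \<sigma> p = word \<tau> p" "w = orbit_path \<tau> p" using word_cong[OF agree] by (auto simp: w_def orbit_path_def)
  let ?A = "orbit_path \<sigma> (Suc p)" and ?B = "orbit_path \<tau> (Suc p)" and ?P = "orbit_path \<sigma> i" and ?Q = "orbit_path \<tau> j"
  have dA: "L \<le> dist w ?A" "dist w ?A \<le> D" using path_steps[OF \<sigma>, of p] by (simp_all add: w_def)
  have dB: "L \<le> dist w ?B" "dist w ?B \<le> D" using path_steps[OF \<tau>, of p] w by simp_all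
  have "dist ?A ?B = dist (\<sigma> p x) (\<tau> p x)"
    using dist_act[OF word_in_group[OF \<tau>, of p], of "\<sigma> p x" "\<tau> p x"] w(1) by (simp add: orbit_path_def)
  then have AB: "D - L + 2 * c + 8 * \<delta> + 1 \<le> dist ?A ?B"
    using S_sep[OF codesD[OF \<sigma>] codesD[OF \<tau>] diff] by simp
  have gA: "dist w ?A - (c + 2 * \<delta>) \<le> gp w ?A ?P"
    using gp_add_gp[of w ?A ?P] path_middle[OF \<sigma>, of p "Suc p" i] ij by (simp add: w_def)
  have gB: "dist w ?B - (c + 2 * \<delta>) \<le> gp w ?Q ?B"
    using gp_add_gp[of w ?B ?Q] path_middle[OF \<tau>, of p "Suc p" j] ij w(2) by (simp add: gp_commute)
  have "gp w ?P ?Q \<le> D"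
  proof (rule ccontr)
    assume "\<not> gp w ?P ?Q \<le> D"
    then have "min (dist w ?A) (dist w ?B) - (c + 2 * \<delta>) - 2 * \<delta> \<le> gp w ?A ?B"
      using gA gB dA dB c_nonneg delta_nonneg by (intro hyp_ge4[of _ w ?A ?P ?Q ?B]) auto
    then show False
      using AB dA dB by (simp add: gromov_product_def min_def field_simps split: if_splits)
  qed
  then show ?thesis
    using gp_change_base[of x ?P ?Q w] path_dist_le[OF \<sigma>, of p] by (simp add: w_def distrib_right)
qed

text \<open>A Baire category argument on the tree of words: otherwise one could descend through cylinders
  successively avoiding all the \<open>C k\<close>, and the resulting limit point would not be covered.\<close>

lemma dense_in_some_cylinder:
  fixes C :: "nat \<Rightarrow> 'a bdry_point set"
  assumes cover: "ergodic_limit_set x \<Gamma> \<subseteq> (\<Union>k. C k)" and ne: "S \<noteq> {}"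
  shows "\<exists>k. \<exists>\<sigma>\<in>codes. \<exists>n. \<forall>\<tau>\<in>codes. \<forall>m. (\<forall>i<n. \<tau> i = \<sigma> i) \<longrightarrow>
    (\<exists>\<rho>\<in>codes. (\<forall>i<m. \<rho> i = \<tau> i) \<and> limit \<rho> \<in> C k)"
proof (rule ccontr)
  assume contra: "\<not> ?thesis"
  define same where "same n \<tau> \<sigma> \<longleftrightarrow> (\<forall>i<n. \<tau> i = \<sigma> i)" for n and \<tau> \<sigma> :: "nat \<Rightarrow> 'a \<Rightarrow> 'a"
  define hit where "hit k m \<tau> \<longleftrightarrow> (\<exists>\<rho>\<in>codes. same m \<rho> \<tau> \<and> limit \<rho> \<in> C k)" for k m \<tau>
  have "\<not> (\<exists>k. \<exists>\<sigma>\<in>codes. \<exists>n. \<forall>\<tau>\<in>codes. \<forall>m. same n \<tau> \<sigma> \<longrightarrow> hit k m \<tau>)"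
    unfolding hit_def same_def by (rule contra)
  then have avoid: "\<exists>\<tau>\<in>codes. \<exists>m. same n \<tau> \<sigma> \<and> \<not> hit k m \<tau>" if "\<sigma> \<in> codes" for k \<sigma> n
    using that by blast
  \<comment> \<open>A pair stands for a cylinder: a code with a prefix length. \<open>Q\<close> says
    that the next cylinder is smaller, has a longer prefix and contains no code with limit in
    \<open>C k\<close>.\<close>
  define Q where "Q k p p' \<longleftrightarrow> snd p < snd p' \<and> same (snd p) (fst p') (fst p) \<and> \<not> hit k (snd p') (fst p')"
    for k and p p' :: "(nat \<Rightarrow> 'a \<Rightarrow> 'a) \<times> nat"
  have "\<exists>p. \<forall>k. (fst (p k) \<in> codes \<and> k \<le> snd (p k)) \<and> Q k (p k) (p (Suc k))"
  proof (rule dependent_nat_choice)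
    obtain s where "s \<in> S" using ne by blast
    then show "\<exists>p. fst p \<in> codes \<and> (0::nat) \<le> snd p" by (intro exI[of _ "(\<lambda>_. s, 0)"]) (simp add: codes_def)
  next
    fix p :: "(nat \<Rightarrow> 'a \<Rightarrow> 'a) \<times> nat" and k assume p: "fst p \<in> codes \<and> k \<le> snd p"
    obtain \<tau> m where \<tau>: "\<tau> \<in> codes" "same (snd p) \<tau> (fst p)" "\<not> hit k m \<tau>"
      using avoid[of "fst p" "snd p" k] p by blast
    have "\<not> hit k (max m (Suc (snd p))) \<tau>"
      using \<tau>(3) unfolding hit_def same_def by (meson less_max_iff_disj)
    then have "Q k p (\<tau>, max m (Suc (snd p)))"
      using \<tau> by (simp add: Q_def)
    then show "\<exists>p'. (fst p' \<in> codes \<and> Suc k \<le> snd p') \<and> Q k p p'"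
      using \<tau>(1) p by (intro exI[of _ "(\<tau>, max m (Suc (snd p)))"]) auto
  qed
  then obtain p where p: "\<And>k. fst (p k) \<in> codes" "\<And>k. k \<le> snd (p k)" "\<And>k. Q k (p k) (p (Suc k))"
    by blast
  have mono: "snd (p k) \<le> snd (p l)" if "k \<le> l" for k l
    using _ that
  proof (rule lift_Suc_mono_le[of "\<lambda>k. snd (p k)"])
    show "snd (p k) \<le> snd (p (Suc k))" for k
      using p(3)[of k] by (simp add: Q_def)
  qed
  have agree: "fst (p l) i = fst (p k) i" if "k \<le> l" "i < snd (p k)" for k l i
    using that(1)
  proof (induction l rule: dec_induct)
    case (step l)
    then have "i < snd (p l)" using that(2) mono[of k l] by simp
    then show ?case using p(3)[of l] step by (simp add: Q_def same_def)
  qed simp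
  \<comment> \<open>Coordinate \<open>i\<close> is already final in the code
    \<open>p (Suc i)\<close>, whose prefix length is at least \<open>Suc i\<close>.\<close>
  define \<rho> where "\<rho> i = fst (p (Suc i)) i" for i
  have "\<rho> \<in> codes" using p(1) by (simp add: codes_def \<rho>_def)
  have \<rho>: "\<rho> i = fst (p k) i" if "i < snd (p k)" for i k
  proof (cases "k \<le> Suc i")
    case True
    then show ?thesis using agree[OF True that] by (simp add: \<rho>_def)
  next
    case False
    moreover have "i < snd (p (Suc i))" using p(2)[of "Suc i"] by simp
    ultimately show ?thesis using agree[of "Suc i" k i] by (simp add: \<rho>_def)
  qed
  have "limit \<rho> \<notin> C k" for k
  proof
    assume "limit \<rho> \<in> C k"
    moreover have "same (snd (p (Suc k))) \<rho> (fst (p (Suc k)))" using \<rho> by (simp add: same_def)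
    ultimately have "hit k (snd (p (Suc k))) (fst (p (Suc k)))"
      using \<open>\<rho> \<in> codes\<close> unfolding hit_def by blast
    then show False using p(3)[of k] by (simp add: Q_def)
  qed
  then show False using limit_ergodic[OF \<open>\<rho> \<in> codes\<close>] cover by blast
qed

text \<open>The fixed prefix of length \<open>n\<close> followed by any word of length
  \<open>m\<close> is the beginning of a code with limit in \<open>B\<close>. Balls of radius
  \<open>r m\<close> around these limits are disjoint, and their sum \<open>K * q ^ m\<close> is
  unbounded because q > 1.\<close>

lemma packing_sup_infinite:
  assumes \<sigma>: "\<sigma> \<in> codes" and card: "exp (\<alpha> * D) < real (card S)" and \<eta>: "0 < \<eta>"
    and dense: "\<And>\<tau> m. \<tau> \<in> codes \<Longrightarrow> (\<forall>i<n. \<tau> i = \<sigma> i) \<Longrightarrow> \<exists>\<rho>\<in>codes. (\<forall>i<m. \<rho> i = \<tau> i) \<and> limit \<rho> \<in> B"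
  shows "packing_sup x \<alpha> B \<eta> = \<infinity>"
proof -
  \<comment> \<open>Codes that differ within the first \<open>n + m\<close> letters have late
    products at most \<open>real (n + m) * D\<close>; the term \<open>3 * \<delta> + 1\<close> beats
    the loss in \<open>visual_balls_meet\<close>.\<close>
  define r where "r m = exp (- (real (n + m) * D + 3 * \<delta> + 1))" for m
  define q where "q = real (card S) * exp (- \<alpha> * D)"
  define K where "K = exp (- \<alpha> * (real n * D + 3 * \<delta> + 1))"
  have "exp (\<alpha> * D) * exp (- \<alpha> * D) < q"
    unfolding q_def using card by (intro mult_strict_right_mono) auto
  then have q: "1 < q" by (simp add: exp_add[symmetric])
  have lower: "ennreal (K * q ^ m) \<le> packing_sup x \<alpha> B \<eta>" if m: "r m \<le> \<eta>" for m
  proof -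
    define V where "V = PiE {..<m} (\<lambda>_. S)"
    have finV: "finite V" "card V = card S ^ m" using S_finite by (auto simp: V_def finite_PiE card_PiE)
    \<comment> \<open>Only the first \<open>n + m\<close> letters matter; the tail of \<sigma>
      merely completes the word to a code.\<close>
    define ext where "ext v i = (if i < n \<or> n + m \<le> i then \<sigma> i else v (i - n))" for v i
    have "\<exists>\<rho>\<in>codes. (\<forall>i<n + m. \<rho> i = ext v i) \<and> limit \<rho> \<in> B" if v: "v \<in> V" for v
    proof (rule dense)
      have "v (i - n) \<in> S" if "n \<le> i" "i < n + m" for i
        using PiE_mem[OF v[unfolded V_def], of "i - n"] that by auto
      then show "ext v \<in> codes" using codesD[OF \<sigma>] by (auto simp: codes_def ext_def)
    qed (simp add: ext_def)
    then have "\<forall>v\<in>V. \<exists>\<rho>. \<rho> \<in> codes \<and> (\<forall>i<n + m. \<rho> i = ext v i) \<and> limit \<rho> \<in> B" by blast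
    then obtain \<rho> where "\<forall>v\<in>V. \<rho> v \<in> codes \<and> (\<forall>i<n + m. \<rho> v i = ext v i) \<and> limit (\<rho> v) \<in> B"
      unfolding bchoice_iff by blast
    then have \<rho>: "\<And>v. v \<in> V \<Longrightarrow> \<rho> v \<in> codes" "\<And>v i. v \<in> V \<Longrightarrow> i < n + m \<Longrightarrow> \<rho> v i = ext v i"
      "\<And>v. v \<in> V \<Longrightarrow> limit (\<rho> v) \<in> B"
      by blast+
    have disj: "visual_ball x (limit (\<rho> v)) (r m) \<inter> visual_ball x (limit (\<rho> v')) (r m) = {}"
      if v: "v \<in> V" "v' \<in> V" "v \<noteq> v'" for v v'
    proof (rule ccontr)
      assume "\<not> ?thesis"
      then obtain w where w: "w \<in> visual_ball x (limit (\<rho> v)) (r m)" "w \<in> visual_ball x (limit (\<rho> v')) (r m)"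
        by blast
      obtain N where N: "\<And>i j. i \<ge> N \<Longrightarrow> j \<ge> N \<Longrightarrow> ln (1 / r m) - 3 * \<delta> \<le> gp x (orbit_path (\<rho> v) i) (orbit_path (\<rho> v') j)"
        using visual_balls_meet[OF limit_boundary(1)[OF \<rho>(1)[OF v(1)]] limit_boundary(1)[OF \<rho>(1)[OF v(2)]] w
          limit_boundary(2)[OF \<rho>(1)[OF v(1)]] limit_boundary(2)[OF \<rho>(1)[OF v(2)]]] by blast
      obtain i where i: "i < m" "v i \<noteq> v' i"
        using PiE_ext[of v "{..<m}" "\<lambda>_. S" v'] v unfolding V_def by auto
      then have ex: "\<rho> v (n + i) \<noteq> \<rho> v' (n + i)" using \<rho>(2) v by (simp add: ext_def)
      define p where "p = (LEAST p. \<rho> v p \<noteq> \<rho> v' p)"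
      have p: "\<rho> v p \<noteq> \<rho> v' p" "\<And>k. k < p \<Longrightarrow> \<rho> v k = \<rho> v' k"
        using LeastI[of "\<lambda>p. \<rho> v p \<noteq> \<rho> v' p", OF ex] not_less_Least[of _ "\<lambda>p. \<rho> v p \<noteq> \<rho> v' p"]
        unfolding p_def by blast+
      have "p \<le> n + i" unfolding p_def by (rule Least_le) (rule ex)
      then have "Suc p \<le> n + m" using i(1) by simp
      then have "real (Suc p) * D \<le> real (n + m) * D" using D_pos by (intro mult_right_mono of_nat_mono) auto
      moreover have "gp x (orbit_path (\<rho> v) (max N (Suc p))) (orbit_path (\<rho> v') (max N (Suc p))) \<le> real (Suc p) * D"
        by (rule path_branching[OF \<rho>(1)[OF v(1)] \<rho>(1)[OF v(2)] p(2) p(1)]) auto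
      moreover have "ln (1 / r m) = real (n + m) * D + 3 * \<delta> + 1" by (simp add: r_def ln_div)
      ultimately show False using N[of "max N (Suc p)" "max N (Suc p)"] by simp
    qed
    obtain h where h: "bij_betw h {0..<card V} V" using ex_bij_betw_nat_finite[OF finV(1)] by blast
    then have hV: "h i \<in> V" if "i \<in> {0..<card V}" for i using that by (rule bij_betwE[THEN bspec])
    have hinj: "h i \<noteq> h j" if "i \<in> {0..<card V}" "j \<in> {0..<card V}" "i \<noteq> j" for i j
      using h that by (auto simp: bij_betw_def inj_on_def)
    have "({0..<card V}, \<lambda>i. limit (\<rho> (h i)), \<lambda>_. r m) \<in> packing_families x B \<eta>"
      unfolding packing_families_def disjoint_family_on_def
      using \<rho>(3)[OF hV] m disj[OF hV hV hinj] by (simp add: r_def)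
    then have "(\<Sum>i\<in>{0..<card V}. ennreal (r m powr \<alpha>)) \<le> packing_sup x \<alpha> B \<eta>"
      by (rule packing_sup_geI) simp
    moreover have "(\<Sum>i\<in>{0..<card V}. ennreal (r m powr \<alpha>)) = ennreal (real (card V) * r m powr \<alpha>)"
      by (simp add: ennreal_mult ennreal_of_nat_eq_real_of_nat)
    moreover have "real (card V) * r m powr \<alpha> = K * q ^ m"
    proof -
      have "r m powr \<alpha> = K * exp (- \<alpha> * D) ^ m"
        by (simp add: r_def K_def powr_def exp_of_nat_mult[symmetric] exp_add[symmetric] algebra_simps)
      then show ?thesis by (simp add: finV(2) q_def power_mult_distrib)
    qed
    ultimately show ?thesis by simp
  qed
  show ?thesis
  proof (rule ccontr)
    assume "packing_sup x \<alpha> B \<eta> \<noteq> \<infinity>"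
    then obtain b where b: "packing_sup x \<alpha> B \<eta> = ennreal b" "0 \<le> b"
      by (cases "packing_sup x \<alpha> B \<eta>") auto
    have "K > 0" by (simp add: K_def)
    obtain m0 where m0: "b / K < q ^ m0" using real_arch_pow[OF q] by blast
    have "r \<longlonglongrightarrow> 0" unfolding r_def using D_pos by real_asymp
    then have "\<forall>\<^sub>F m in sequentially. r m < \<eta>" using \<eta> by (rule order_tendstoD(2))
    then obtain m1 where m1: "\<And>m. m \<ge> m1 \<Longrightarrow> r m < \<eta>" unfolding eventually_sequentially by blast
    define m where "m = max m0 m1"
    have "ennreal (K * q ^ m) \<le> ennreal b" using lower[of m] m1[of m] b by (simp add: m_def)
    then have "K * q ^ m \<le> b" using b(2) by (simp add: ennreal_le_iff)
    moreover have "q ^ m0 \<le> q ^ m" using q by (intro power_increasing) (auto simp: m_def)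
    ultimately show False using m0 \<open>K > 0\<close> by (simp add: field_simps) (smt (verit) mult_left_mono)
  qed
qed

theorem packing_measure_ergodic_infinite:
  assumes "exp (\<alpha> * D) < real (card S)"
  shows "packing_measure x \<alpha> (ergodic_limit_set x \<Gamma>) = \<infinity>"
proof -
  have "(\<Sum>k. packing_premeasure x \<alpha> (C k)) = \<infinity>" if cover: "ergodic_limit_set x \<Gamma> \<subseteq> (\<Union>k. C k)"
    for C :: "nat \<Rightarrow> 'a bdry_point set"
  proof -
    have "S \<noteq> {}" using assms exp_gt_zero[of "\<alpha> * D"] by auto
    from dense_in_some_cylinder[OF cover this]
    obtain k \<sigma> n where \<sigma>: "\<sigma> \<in> codes" and dense: "\<forall>\<tau>\<in>codes. \<forall>m. (\<forall>i<n. \<tau> i = \<sigma> i) \<longrightarrow>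
        (\<exists>\<rho>\<in>codes. (\<forall>i<m. \<rho> i = \<tau> i) \<and> limit \<rho> \<in> C k)"
      by (elim exE bexE)
    have "packing_sup x \<alpha> (C k) \<eta> = \<infinity>" if "0 < \<eta>" for \<eta>
      by (rule packing_sup_infinite[OF \<sigma> assms that]) (rule dense[THEN bspec, THEN spec, THEN mp])
    then have "packing_premeasure x \<alpha> (C k) = \<infinity>"
      unfolding packing_premeasure_eq_INF
      by (simp cong: INF_cong)
    moreover have "packing_premeasure x \<alpha> (C k) \<le> (\<Sum>k. packing_premeasure x \<alpha> (C k))"
      using sum_le_suminf[of "\<lambda>k. packing_premeasure x \<alpha> (C k)" "{k}"] by simp
    ultimately show ?thesis by (simp add: top_unique)
  qed
  then show ?thesis
    unfolding packing_measure_def infinity_ennreal_def by (intro antisym top_greatest INF_greatest) auto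
qed

end

section \<open>The packing dimension\<close>

theorem theorem1:
  fixes x :: "'a::metric_space" and \<delta> :: real and \<Gamma> :: "('a \<Rightarrow> 'a) set"
  assumes "proper_space TYPE('a)"
    and "hyperbolic_space \<delta> TYPE('a)"
    and "subgroup \<Gamma> isom_group"
    and "discrete_isoms \<Gamma>"
    and "non_elementary x \<Gamma>"
  shows "critical_exponent x \<Gamma> = packing_dim x (ergodic_limit_set x \<Gamma>)"
proof -
  interpret discrete_action x \<delta> \<Gamma>
    using assms(2) unfolding hyperbolic_space_def
    by (intro discrete_action.intro gromov_hyperbolic.intro discrete_action_axioms.intro assms) auto
  have "packing_measure x \<alpha> (ergodic_limit_set x \<Gamma>) = \<infinity>"
    if \<alpha>: "0 \<le> \<alpha>" "ereal \<alpha> < critical_exponent x \<Gamma>" for \<alpha>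
  proof -
    \<comment> \<open>An intermediate exponent is positive even if \<alpha> is 0, as
      \<open>schottky_set_exists\<close> demands; its Schottky set also serves \<alpha>, because D >
      0.\<close>
    obtain \<beta> where \<beta>: "\<alpha> < \<beta>" "ereal \<beta> < critical_exponent x \<Gamma>"
      using ereal_dense2[OF \<alpha>(2)] by auto
    then have "\<not> light \<beta> \<Gamma>" "0 < \<beta>" using \<alpha>(1) not_light_all[of \<beta>] by simp_all
    then obtain S c L D where S: "schottky_set S c L D" "exp (\<beta> * D) < real (card S)"
      using schottky_set_exists assms(5) by blast
    interpret schottky_action x \<delta> \<Gamma> S c L D
      by unfold_locales (rule S(1))
    have "exp (\<alpha> * D) \<le> exp (\<beta> * D)" using \<beta>(1) D_pos by simp
    from le_less_trans[OF this S(2)] show ?thesis by (rule packing_measure_ergodic_infinite)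
  qed
  then have "is_packing_dim x (ergodic_limit_set x \<Gamma>) (critical_exponent x \<Gamma>)"
    unfolding is_packing_dim_def using critical_exponent_nonneg packing_measure_ergodic_zero by blast
  then show ?thesis
    unfolding packing_dim_def by (rule the1_equality[OF ex1_packing_dim, symmetric])
qed

end
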